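(* Let $\mathcal{M}$ be a type $\mathrm{III}$ factor acting on a separable Hilbert space and let $|||\cdot|||$ be a unitarily invariant semi-norm associated to $\mathcal{M}$. Then there exists $a>0$ such that $|||\cdot|||=a\|\cdot\|$, i.e. $|||T|||=a\|T\|$ for all $T\in\mathcal{M}$.
   Context: $\|\cdot\|$ is the operator norm. A (generalized) semi-norm associated to a von Neumann algebra $\mathcal{M}$ is a map $|||\cdot|||:\mathcal{M}\to[0,\infty]$ such that $|||\lambda T|||=|\lambda|\cdot|||T|||$ (with $0\cdot\infty=0$) and $|||S+T|||\le|||S|||+|||T|||$ for all $S,T\in\mathcal{M}$, $\lambda\in\mathbb{C}$, and such that $0<|||T|||<\infty$ for some non-zero $T\in\mathcal{M}$. It is unitarily invariant if $|||UTV|||=|||T|||$ for all $T\in\mathcal{M}$ and unitaries $U,V\in\mathcal{M}$. *)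

theory Defs
  imports "HOL-Analysis.Analysis"
begin

text \<open>
  Complex Hilbert spaces. The library provides the norm, topology and completeness through the
  underlying real Hilbert space, whose inner product is the real part of the complex one.
  The complex inner product is linear in the first argument.
\<close>

class complex_hilbert_space = real_inner + banach +
  fixes scaleC :: "complex \<Rightarrow> 'a \<Rightarrow> 'a"  (infixr \<open>*\<^sub>C\<close> 75)
    and cinner :: "'a \<Rightarrow> 'a \<Rightarrow> complex"
  assumes scaleC_add_right: "c *\<^sub>C (x + y) = c *\<^sub>C x + c *\<^sub>C y"
    and scaleC_add_left: "(c + d) *\<^sub>C x = c *\<^sub>C x + d *\<^sub>C x"
    and scaleC_scaleC: "c *\<^sub>C (d *\<^sub>C x) = (c * d) *\<^sub>C x"
    and scaleC_of_real: "complex_of_real r *\<^sub>C x = r *\<^sub>R x"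
    and cinner_commute: "cinner x y = cnj (cinner y x)"
    and cinner_add_left: "cinner (x + y) z = cinner x z + cinner y z"
    and cinner_scaleC_left: "cinner (c *\<^sub>C x) y = c * cinner x y"
    and Re_cinner: "Re (cinner x y) = inner x y"
begin

lemma cinner_self: "cinner x x = complex_of_real ((norm x)\<^sup>2)"
proof (rule complex_eqI)
  show "Re (cinner x x) = Re (complex_of_real ((norm x)\<^sup>2))"
    by (simp add: Re_cinner power2_norm_eq_inner)
  show "Im (cinner x x) = Im (complex_of_real ((norm x)\<^sup>2))"
    using arg_cong[OF cinner_commute[of x x], of Im] by simp
qed

lemma norm_scaleC: "norm (c *\<^sub>C x) = cmod c * norm x"
proof -
  have "cinner (c *\<^sub>C x) (c *\<^sub>C x) = c * cnj (c * cinner x x)"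
    by (metis cinner_commute cinner_scaleC_left)
  also have "\<dots> = complex_of_real ((cmod c * norm x)\<^sup>2)"
    using complex_norm_square[of c]
    by (simp add: cinner_self power_mult_distrib mult.assoc[symmetric])
  finally have "(norm (c *\<^sub>C x))\<^sup>2 = (cmod c * norm x)\<^sup>2"
    unfolding cinner_self of_real_eq_iff .
  then show ?thesis by simp
qed

end

text \<open>
  The library type of bounded operators consists of real-linear maps; $B(H)$ is the set of
  complex-linear ones. The library norm on this type is the operator norm.
\<close>

definition BH :: "('a::complex_hilbert_space \<Rightarrow>\<^sub>L 'a) set" where
  "BH = {T. \<forall>c x. blinfun_apply T (c *\<^sub>C x) = c *\<^sub>C blinfun_apply T x}"

definition op_scale ::
    "complex \<Rightarrow> ('a::complex_hilbert_space \<Rightarrow>\<^sub>L 'a) \<Rightarrow> ('a \<Rightarrow>\<^sub>L 'a)" where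
  "op_scale c T = Blinfun (\<lambda>x. c *\<^sub>C blinfun_apply T x)"

lemma op_scale_apply: "blinfun_apply (op_scale c T) x = c *\<^sub>C blinfun_apply T x"
proof -
  have "bounded_linear (\<lambda>x. c *\<^sub>C blinfun_apply T x)"
  proof (rule bounded_linear_intro)
    fix x y r
    show "c *\<^sub>C blinfun_apply T (x + y) = c *\<^sub>C blinfun_apply T x + c *\<^sub>C blinfun_apply T y"
      by (simp add: blinfun.add_right scaleC_add_right)
    show "c *\<^sub>C blinfun_apply T (r *\<^sub>R x) = r *\<^sub>R (c *\<^sub>C blinfun_apply T x)"
      unfolding blinfun.scaleR_right
      by (simp add: mult.commute scaleC_scaleC flip: scaleC_of_real)
    show "norm (c *\<^sub>C blinfun_apply T x) \<le> norm x * (cmod c * norm T)"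
      using mult_left_mono[OF norm_blinfun[of T x] norm_ge_zero[of c]]
      by (simp add: norm_scaleC mult_ac)
  qed
  then show ?thesis
    by (simp add: op_scale_def bounded_linear_Blinfun_apply)
qed

text \<open>The adjoint exists for complex-linear operators by the Riesz representation theorem.\<close>

definition op_adj :: "('a::complex_hilbert_space \<Rightarrow>\<^sub>L 'a) \<Rightarrow> ('a \<Rightarrow>\<^sub>L 'a)" where
  "op_adj T =
    (THE S. \<forall>x y. cinner (blinfun_apply T x) y = cinner x (blinfun_apply S y))"

definition commutant ::
    "('a::complex_hilbert_space \<Rightarrow>\<^sub>L 'a) set \<Rightarrow> ('a \<Rightarrow>\<^sub>L 'a) set" where
  "commutant S = {T \<in> BH. \<forall>A\<in>S. T o\<^sub>L A = A o\<^sub>L T}"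

definition von_neumann_algebra :: "('a::complex_hilbert_space \<Rightarrow>\<^sub>L 'a) set \<Rightarrow> bool" where
  "von_neumann_algebra M \<longleftrightarrow>
     M \<subseteq> BH \<and> id_blinfun \<in> M \<and>
     (\<forall>S\<in>M. \<forall>T\<in>M. S + T \<in> M) \<and>
     (\<forall>c. \<forall>T\<in>M. op_scale c T \<in> M) \<and>
     (\<forall>S\<in>M. \<forall>T\<in>M. S o\<^sub>L T \<in> M) \<and>
     (\<forall>T\<in>M. op_adj T \<in> M) \<and>
     commutant (commutant M) = M"

definition factor :: "('a::complex_hilbert_space \<Rightarrow>\<^sub>L 'a) set \<Rightarrow> bool" where
  "factor M \<longleftrightarrow>
     von_neumann_algebra M \<and> M \<inter> commutant M = range (\<lambda>c. op_scale c id_blinfun)"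

definition unitaries ::
    "('a::complex_hilbert_space \<Rightarrow>\<^sub>L 'a) set \<Rightarrow> ('a \<Rightarrow>\<^sub>L 'a) set" where
  "unitaries M = {U \<in> M. op_adj U o\<^sub>L U = id_blinfun \<and> U o\<^sub>L op_adj U = id_blinfun}"

definition projections ::
    "('a::complex_hilbert_space \<Rightarrow>\<^sub>L 'a) set \<Rightarrow> ('a \<Rightarrow>\<^sub>L 'a) set" where
  "projections M = {P \<in> M. P o\<^sub>L P = P \<and> op_adj P = P}"

definition proj_le ::
    "('a::complex_hilbert_space \<Rightarrow>\<^sub>L 'a) \<Rightarrow> ('a \<Rightarrow>\<^sub>L 'a) \<Rightarrow> bool" where
  "proj_le P Q \<longleftrightarrow> range (blinfun_apply P) \<subseteq> range (blinfun_apply Q)"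

text \<open>Murray--von Neumann equivalence relative to $M$.\<close>

definition mvn_equiv ::
    "('a::complex_hilbert_space \<Rightarrow>\<^sub>L 'a) set \<Rightarrow> ('a \<Rightarrow>\<^sub>L 'a) \<Rightarrow> ('a \<Rightarrow>\<^sub>L 'a) \<Rightarrow> bool" where
  "mvn_equiv M P Q \<longleftrightarrow> (\<exists>V\<in>M. op_adj V o\<^sub>L V = P \<and> V o\<^sub>L op_adj V = Q)"

definition finite_projection ::
    "('a::complex_hilbert_space \<Rightarrow>\<^sub>L 'a) set \<Rightarrow> ('a \<Rightarrow>\<^sub>L 'a) \<Rightarrow> bool" where
  "finite_projection M P \<longleftrightarrow>
     P \<in> projections M \<and>
     (\<forall>Q\<in>projections M. mvn_equiv M P Q \<and> proj_le Q P \<longrightarrow> Q = P)"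

definition type_III :: "('a::complex_hilbert_space \<Rightarrow>\<^sub>L 'a) set \<Rightarrow> bool" where
  "type_III M \<longleftrightarrow> (\<forall>P\<in>projections M. finite_projection M P \<longrightarrow> P = 0)"

text \<open>
  Only the values of \<open>N\<close> on \<open>M\<close> matter. In \<^typ>\<open>ennreal\<close> the product of \<open>0\<close> and \<open>\<infinity>\<close> is \<open>0\<close>.
\<close>

definition generalized_seminorm ::
    "('a::complex_hilbert_space \<Rightarrow>\<^sub>L 'a) set \<Rightarrow> (('a \<Rightarrow>\<^sub>L 'a) \<Rightarrow> ennreal) \<Rightarrow> bool" where
  "generalized_seminorm M N \<longleftrightarrow>
     (\<forall>c. \<forall>T\<in>M. N (op_scale c T) = ennreal (cmod c) * N T) \<and>
     (\<forall>S\<in>M. \<forall>T\<in>M. N (S + T) \<le> N S + N T) \<and>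
     (\<exists>T\<in>M. T \<noteq> 0 \<and> 0 < N T \<and> N T < \<infinity>)"

definition unitarily_invariant ::
    "('a::complex_hilbert_space \<Rightarrow>\<^sub>L 'a) set \<Rightarrow> (('a \<Rightarrow>\<^sub>L 'a) \<Rightarrow> ennreal) \<Rightarrow> bool" where
  "unitarily_invariant M N \<longleftrightarrow>
     (\<forall>T\<in>M. \<forall>U\<in>unitaries M. \<forall>V\<in>unitaries M. N (U o\<^sub>L T o\<^sub>L V) = N T)"

end

theory Submission
  imports Defs
begin

text \<open>
  Every strict contraction of \<open>M\<close> is, up to an error of order \<open>1/n\<close>, a mean of unitaries of \<open>M\<close>
  (Kadison--Pedersen), so a unitarily invariant seminorm satisfies
  \<open>N (A T B) \<le> \<parallel>A\<parallel> N T \<parallel>B\<parallel>\<close>; in particular \<open>N T \<le> \<parallel>T\<parallel> N 1\<close>.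
  Conversely let \<open>d < \<parallel>T\<parallel>\<close>. Some nonzero spectral projection \<open>E\<close> of \<open>T\<^sup>* T\<close> has \<open>T\<close> bounded below
  by a constant larger than \<open>d\<close> on its range. As \<open>E\<close> is infinite, its range contains infinitely many
  mutually orthogonal copies of some nonzero \<open>G\<close>, and the identity is a countable sum of projections
  that are almost isometric to parts of \<open>G\<close>. This gives an almost isometric contraction \<open>W \<in> M\<close> from
  the whole space into the range of \<open>E\<close>. Then \<open>T W\<close> has a left inverse of norm at most \<open>1/d\<close>, so
  \<open>d N 1 \<le> N T\<close>. Working with almost isometries instead of partial isometries avoids polar
  decompositions of non-invertible operators and most of comparison theory.
\<close>

section \<open>Orthogonal projections and adjoints\<close>

text \<open>A minimizing sequence is Cauchy by the parallelogram law, because the midpoint of two of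
  its terms stays in \<open>S\<close> and so cannot beat the infimum \<open>D\<close>.\<close>

lemma closed_subspace_nearest_point:
  fixes S :: "'a::{real_inner,banach} set"
  assumes "closed S" "subspace S"
  obtains y where "y \<in> S" "\<And>z. z \<in> S \<Longrightarrow> norm (x - y) \<le> norm (x - z)"
proof -
  define A where "A = (\<lambda>z. (norm (x - z))\<^sup>2) ` S"
  define D where "D = Inf A"
  have ne: "A \<noteq> {}" using subspace_0[OF assms(2)] by (auto simp: A_def)
  have bdd: "bdd_below A" by (auto simp: A_def intro!: bdd_belowI[of _ 0])
  have D_le: "D \<le> (norm (x - z))\<^sup>2" if "z \<in> S" for z
    unfolding D_def by (rule cInf_lower[OF _ bdd]) (use that in \<open>auto simp: A_def\<close>)
  have "\<exists>z\<in>S. (norm (x - z))\<^sup>2 < D + inverse (real (Suc n))" for n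
  proof -
    have "Inf A < D + inverse (real (Suc n))" by (simp add: D_def)
    then show ?thesis using cInf_lessD[OF ne] by (force simp: A_def)
  qed
  then obtain y where yS: "\<And>n. y n \<in> S"
    and y: "\<And>n. (norm (x - y n))\<^sup>2 < D + inverse (real (Suc n))" by metis
  have dist_y: "(norm (y m - y n))\<^sup>2 \<le> 2 * inverse (real (Suc m)) + 2 * inverse (real (Suc n))"
    for m n
  proof -
    have "(1/2) *\<^sub>R (y m + y n) \<in> S"
      using assms(2) yS by (intro subspace_scale subspace_add)
    note D_le[OF this]
    moreover have "(norm (y m - y n))\<^sup>2 = 2 * (norm (x - y m))\<^sup>2 + 2 * (norm (x - y n))\<^sup>2
        - 4 * (norm (x - (1/2) *\<^sub>R (y m + y n)))\<^sup>2"
      unfolding power2_norm_eq_inner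
      by (simp add: inner_diff inner_add inner_commute algebra_simps)
    ultimately show ?thesis using y[of m] y[of n] by linarith
  qed
  have "Cauchy y"
  proof (rule metric_CauchyI)
    fix e :: real assume e: "e > 0"
    obtain k where k: "inverse (real (Suc k)) < e\<^sup>2 / 4"
      using reals_Archimedean[of "e\<^sup>2 / 4"] e by auto
    have "dist (y m) (y n) < e" if "m \<ge> k" "n \<ge> k" for m n
    proof -
      have "inverse (real (Suc m)) \<le> inverse (real (Suc k))"
        "inverse (real (Suc n)) \<le> inverse (real (Suc k))"
        using that by (auto intro!: le_imp_inverse_le)
      then have "(norm (y m - y n))\<^sup>2 < e\<^sup>2" using dist_y[of m n] k by linarith
      then show ?thesis using e by (simp add: dist_norm power2_less_imp_less)
    qed
    then show "\<exists>M. \<forall>m\<ge>M. \<forall>n\<ge>M. dist (y m) (y n) < e" by blast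
  qed
  then obtain z where z: "y \<longlonglongrightarrow> z" using Cauchy_convergent_iff convergent_def by blast
  have zS: "z \<in> S" using closed_sequentially[OF assms(1) yS z] .
  have xz: "(norm (x - z))\<^sup>2 \<le> D + 0"
  proof (rule LIMSEQ_le)
    show "(\<lambda>n. (norm (x - y n))\<^sup>2) \<longlonglongrightarrow> (norm (x - z))\<^sup>2"
      by (intro tendsto_intros z)
    show "(\<lambda>n. D + inverse (real (Suc n))) \<longlonglongrightarrow> D + 0"
      by (intro tendsto_intros LIMSEQ_inverse_real_of_nat)
    show "\<exists>N. \<forall>n\<ge>N. (norm (x - y n))\<^sup>2 \<le> D + inverse (real (Suc n))"
      using y less_imp_le by blast
  qed
  have "norm (x - z) \<le> norm (x - w)" if "w \<in> S" for w
  proof (rule power2_le_imp_le)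
    show "(norm (x - z))\<^sup>2 \<le> (norm (x - w))\<^sup>2" using D_le[OF that] xz by linarith
  qed simp
  with zS show thesis using that by blast
qed

lemma orthogonal_projection_point:
  fixes S :: "'a::{real_inner,banach} set"
  assumes "closed S" "subspace S"
  obtains y where "y \<in> S" "\<And>z. z \<in> S \<Longrightarrow> inner (x - y) z = 0"
proof -
  obtain y where y: "y \<in> S" "\<And>z. z \<in> S \<Longrightarrow> norm (x - y) \<le> norm (x - z)"
    using closed_subspace_nearest_point[OF assms] by blast
  have "inner (x - y) z = 0" if z: "z \<in> S" for z
  proof (rule ccontr)
    assume nz: "inner (x - y) z \<noteq> 0"
    define a where "a = inner (x - y) z"
    \<comment> \<open>The minimizer of the squared distance from \<open>x\<close> to the line
      through \<open>y\<close> in direction \<open>z\<close>; it would give a point strictly closer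
      than \<open>y\<close>.\<close>
    define t where "t = a / inner z z"
    have zz: "inner z z > 0" using nz by auto
    have "y + t *\<^sub>R z \<in> S" using y(1) z assms(2) by (intro subspace_add subspace_scale)
    from y(2)[OF this] have "(norm (x - y))\<^sup>2 \<le> (norm (x - (y + t *\<^sub>R z)))\<^sup>2"
      by (simp add: power_mono)
    also have "\<dots> = (norm (x - y))\<^sup>2 - 2 * t * a + t\<^sup>2 * inner z z"
      unfolding power2_norm_eq_inner a_def
      by (simp add: inner_diff inner_add inner_commute algebra_simps power2_eq_square)
    also have "\<dots> = (norm (x - y))\<^sup>2 - a\<^sup>2 / inner z z"
      using zz by (simp add: t_def power2_eq_square field_simps)
    finally have "a\<^sup>2 / inner z z \<le> 0" by simp
    then show False using zz nz by (simp add: a_def divide_le_0_iff)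
  qed
  with y(1) show thesis using that by blast
qed

text \<open>Orthogonality of the residual determines the projected point (\<open>p_eq\<close>), and
  linearity is read off from this uniqueness.\<close>

lemma orthogonal_projection_exists:
  fixes S :: "'a::{real_inner,banach} set"
  assumes "closed S" "subspace S"
  obtains P :: "'a \<Rightarrow>\<^sub>L 'a" where "\<And>x. P x \<in> S" "\<And>x. x \<in> S \<Longrightarrow> P x = x"
    "\<And>x z. z \<in> S \<Longrightarrow> inner (x - P x) z = 0"
proof -
  have "\<exists>y\<in>S. \<forall>z\<in>S. inner (x - y) z = 0" for x
    using orthogonal_projection_point[OF assms] by metis
  then obtain p where pS: "\<And>x. p x \<in> S" and p: "\<And>x z. z \<in> S \<Longrightarrow> inner (x - p x) z = 0"
    by metis
  have p_eq: "p x = y" if "y \<in> S" "\<And>z. z \<in> S \<Longrightarrow> inner (x - y) z = 0" for x y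
  proof -
    have d: "p x - y \<in> S" using assms(2) pS that(1) by (rule subspace_diff)
    have "inner (p x - y) (p x - y) = inner (x - y) (p x - y) - inner (x - p x) (p x - y)"
      by (simp add: inner_diff_left)
    also have "\<dots> = 0" using that(2)[OF d] p[OF d] by simp
    finally show ?thesis by simp
  qed
  have "bounded_linear p"
  proof (rule bounded_linear_intro)
    show "p (x + y) = p x + p y" for x y
    proof (rule p_eq)
      show "p x + p y \<in> S" using assms(2) pS by (intro subspace_add)
      show "inner (x + y - (p x + p y)) z = 0" if "z \<in> S" for z
        using p[OF that, of x] p[OF that, of y] by (simp add: inner_diff_left inner_add_left)
    qed
    show "p (r *\<^sub>R x) = r *\<^sub>R p x" for r x
    proof (rule p_eq)
      show "r *\<^sub>R p x \<in> S" using assms(2) pS by (intro subspace_scale)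
      show "inner (r *\<^sub>R x - r *\<^sub>R p x) z = 0" if "z \<in> S" for z
        using p[OF that, of x] by (simp flip: scaleR_diff_right)
    qed
    show "norm (p x) \<le> norm x * 1" for x
    proof -
      have "inner x (p x) = inner (p x) (p x)" using p[OF pS, of x x] by (simp add: inner_diff_left)
      then have "(norm (p x))\<^sup>2 \<le> norm x * norm (p x)"
        by (metis power2_norm_eq_inner norm_cauchy_schwarz)
      then show ?thesis by (cases "p x = 0") (simp_all add: power2_eq_square)
    qed
  qed
  then have ap: "blinfun_apply (Blinfun p) = p" by (rule bounded_linear_Blinfun_apply)
  show thesis
    by (rule that[of "Blinfun p"]) (use pS p p_eq in \<open>auto simp: ap\<close>)
qed

text \<open>For nonzero \<open>f\<close>, the residual \<open>v\<close> of a vector outside the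
  kernel is orthogonal to the kernel, and every \<open>x\<close> differs from a multiple of
  \<open>v\<close> by an element of the kernel.\<close>

lemma riesz_representation:
  fixes f :: "'a::{real_inner,banach} \<Rightarrow>\<^sub>L real"
  obtains y where "\<And>x. f x = inner x y"
proof (cases "f = 0")
  case True
  then show thesis using that[of 0] by simp
next
  case False
  then obtain u where u: "f u \<noteq> 0" using blinfun_eqI[of f 0] by auto
  let ?S = "{x. f x = 0}"
  have cl: "closed ?S" by (intro closed_Collect_eq continuous_intros)
  have sub: "subspace ?S" by (auto simp: subspace_def blinfun.bilinear_simps)
  obtain w where w: "w \<in> ?S" "\<And>z. z \<in> ?S \<Longrightarrow> inner (u - w) z = 0"
    using orthogonal_projection_point[OF cl sub] by blast
  define v where "v = u - w"
  have fv: "f v \<noteq> 0" using u w(1) by (simp add: v_def blinfun.bilinear_simps)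
  then have vv: "inner v v \<noteq> 0" by auto
  have "f x = inner x ((f v / inner v v) *\<^sub>R v)" for x
  proof -
    have "x - (f x / f v) *\<^sub>R v \<in> ?S" using fv by (simp add: blinfun.bilinear_simps)
    from w(2)[OF this] have "inner v x = (f x / f v) * inner v v"
      by (simp add: v_def[symmetric] inner_diff_right)
    then show ?thesis using fv vv by (simp add: inner_commute)
  qed
  then show thesis using that by blast
qed

text \<open>Riesz representation applied to \<open>inner (T x) y\<close> as a functional of
  \<open>x\<close>. Only the underlying real space is involved; \<open>op_adjI\<close> makes the
  passage to \<open>cinner\<close>.\<close>

lemma real_adjoint_exists:
  fixes T :: "'a::{real_inner,banach} \<Rightarrow>\<^sub>L 'a"
  obtains S :: "'a \<Rightarrow>\<^sub>L 'a" where "\<And>x y. inner (T x) y = inner x (S y)"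
proof -
  have "\<exists>z. \<forall>x. inner (T x) y = inner x z" for y
  proof -
    have bl: "bounded_linear (\<lambda>x. inner (T x) y)"
      by (intro bounded_linear_intros)
    obtain z where "\<And>x. Blinfun (\<lambda>x. inner (T x) y) x = inner x z"
      using riesz_representation by blast
    then show ?thesis using bounded_linear_Blinfun_apply[OF bl] by auto
  qed
  then obtain s where s: "\<And>x y. inner (T x) y = inner x (s y)" by metis
  have s_eq: "s y = z" if z: "\<And>x. inner (T x) y = inner x z" for y z
  proof -
    have "inner (s y - z) (s y - z) = inner (T (s y - z)) y - inner (T (s y - z)) y"
      unfolding inner_diff_right[of _ "s y" z] s[symmetric] z[symmetric] ..
    then show ?thesis by simp
  qed
  have "bounded_linear s"
  proof (rule bounded_linear_intro)
    show "s (x + y) = s x + s y" for x y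
      by (rule s_eq) (simp add: inner_add_right s)
    show "s (r *\<^sub>R x) = r *\<^sub>R s x" for r x
      by (rule s_eq) (simp add: s)
    show "norm (s x) \<le> norm x * norm T" for x
    proof -
      have "(norm (s x))\<^sup>2 = inner (T (s x)) x"
        by (simp add: s power2_norm_eq_inner)
      also have "\<dots> \<le> norm (T (s x)) * norm x" by (rule norm_cauchy_schwarz)
      also have "\<dots> \<le> (norm T * norm (s x)) * norm x"
        by (intro mult_right_mono norm_blinfun) auto
      finally show ?thesis by (cases "s x = 0") (simp_all add: power2_eq_square mult_ac)
    qed
  qed
  then show thesis using that[of "Blinfun s"] s by (simp add: bounded_linear_Blinfun_apply)
qed

section \<open>Adjoints of complex-linear operators\<close>

lemma Im_cinner: "Im (cinner x y) = - inner (\<i> *\<^sub>C x) y"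
  for x :: "'a::complex_hilbert_space"
  by (simp add: cinner_scaleC_left flip: Re_cinner)

text \<open>The imaginary part of \<open>cinner\<close> is a real part after multiplying
  \<open>x\<close> by \<open>\<i>\<close>, and \<open>T\<close> commutes with that multiplication.
  Adjoints can thus be handled through the real inner product alone.\<close>

lemma op_adjI:
  fixes T S :: "'a::complex_hilbert_space \<Rightarrow>\<^sub>L 'a"
  assumes "T \<in> BH" "\<And>x y. inner (T x) y = inner x (S y)"
  shows "op_adj T = S"
  unfolding op_adj_def
proof (rule the_equality)
  have "cinner (T x) y = cinner x (S y)" for x y
  proof (rule complex_eqI)
    show "Re (cinner (T x) y) = Re (cinner x (S y))" by (simp add: Re_cinner assms)
    have "\<i> *\<^sub>C T x = T (\<i> *\<^sub>C x)" using assms(1) by (simp add: BH_def)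
    then show "Im (cinner (T x) y) = Im (cinner x (S y))" by (simp add: Im_cinner assms(2))
  qed
  then show "\<forall>x y. cinner (T x) y = cinner x (S y)" by blast
next
  fix R :: "'a \<Rightarrow>\<^sub>L 'a"
  assume R: "\<forall>x y. cinner (T x) y = cinner x (R y)"
  show "R = S"
  proof (rule blinfun_eqI)
    fix y
    have "inner x (R y - S y) = 0" for x
    proof -
      have "inner x (R y) = inner (T x) y" using R by (simp flip: Re_cinner)
      then show ?thesis by (simp add: assms(2) inner_diff_right)
    qed
    from this[of "R y - S y"] show "R y = S y" by simp
  qed
qed

lemma op_adj_inner:
  fixes T :: "'a::complex_hilbert_space \<Rightarrow>\<^sub>L 'a"
  assumes "T \<in> BH"
  shows "inner (T x) y = inner x (op_adj T y)"
proof -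
  obtain S :: "'a \<Rightarrow>\<^sub>L 'a" where S: "\<And>x y. inner (T x) y = inner x (S y)"
    using real_adjoint_exists[of T] by blast
  then show ?thesis using op_adjI[OF assms S] by simp
qed

lemma op_adj_inner':
  fixes T :: "'a::complex_hilbert_space \<Rightarrow>\<^sub>L 'a"
  assumes "T \<in> BH"
  shows "inner (op_adj T x) y = inner x (T y)"
  using op_adj_inner[OF assms, of y x] by (simp add: inner_commute)

lemma inner_scaleC_left: "inner (c *\<^sub>C x) y = inner x (cnj c *\<^sub>C y)"
  for x :: "'a::complex_hilbert_space"
proof -
  have "cinner (c *\<^sub>C x) y = cinner x (cnj c *\<^sub>C y)"
    by (metis cinner_commute cinner_scaleC_left complex_cnj_cnj complex_cnj_mult)
  then show ?thesis by (metis Re_cinner)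
qed

section \<open>Operators of a von Neumann algebra\<close>

text \<open>The real orthogonal projection onto a complex subspace is complex-linear, since
  orthogonality to \<open>K\<close> survives complex multiples. The last clause holds because
  \<open>A\<close> preserves \<open>K\<close> and, through its adjoint, the orthogonal complement of
  \<open>K\<close>.\<close>

lemma complex_subspace_projection:
  fixes K :: "'a::complex_hilbert_space set"
  assumes "subspace K" "\<And>c x. x \<in> K \<Longrightarrow> c *\<^sub>C x \<in> K" "closed K"
  obtains P :: "'a \<Rightarrow>\<^sub>L 'a" where "P \<in> BH" "op_adj P = P" "P o\<^sub>L P = P" "range P = K"
    "\<And>A. A \<in> BH \<Longrightarrow> (\<And>x. x \<in> K \<Longrightarrow> A x \<in> K) \<Longrightarrow> (\<And>x. x \<in> K \<Longrightarrow> op_adj A x \<in> K) \<Longrightarrow> P o\<^sub>L A = A o\<^sub>L P"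
proof -
  obtain P :: "'a \<Rightarrow>\<^sub>L 'a" where PK: "\<And>x. P x \<in> K" and P_id: "\<And>x. x \<in> K \<Longrightarrow> P x = x"
    and orth: "\<And>x z. z \<in> K \<Longrightarrow> inner (x - P x) z = 0"
    using orthogonal_projection_exists[OF assms(3,1)] by blast
  have P_eqI: "P x = y" if "y \<in> K" "\<And>z. z \<in> K \<Longrightarrow> inner (x - y) z = 0" for x y
  proof -
    have d: "P x - y \<in> K" using assms(1) PK that(1) by (rule subspace_diff)
    have "inner (P x - y) (P x - y) = inner (x - y) (P x - y) - inner (x - P x) (P x - y)"
      by (simp add: inner_diff_left)
    also have "\<dots> = 0" using that(2)[OF d] orth[OF d] by simp
    finally show ?thesis by simp
  qed
  have BH: "P \<in> BH"
  proof -
    have "P (c *\<^sub>C x) = c *\<^sub>C P x" for c x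
    proof (rule P_eqI)
      show "c *\<^sub>C P x \<in> K" using assms(2) PK .
      fix z assume z: "z \<in> K"
      have "c *\<^sub>C x = c *\<^sub>C (x - P x) + c *\<^sub>C P x" by (simp flip: scaleC_add_right)
      then have "inner (c *\<^sub>C x - c *\<^sub>C P x) z = inner (c *\<^sub>C (x - P x)) z" by simp
      also have "\<dots> = 0" by (simp add: inner_scaleC_left orth assms(2) z)
      finally show "inner (c *\<^sub>C x - c *\<^sub>C P x) z = 0" .
    qed
    then show ?thesis by (simp add: BH_def)
  qed
  have adj: "op_adj P = P"
  proof (rule op_adjI[OF BH])
    fix x y
    show "inner (P x) y = inner x (P y)"
      using orth[OF PK, of x y] orth[OF PK, of y x]
      by (simp add: inner_diff_left inner_commute[of "P x"])
  qed
  have commute: "P o\<^sub>L A = A o\<^sub>L P"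
    if A: "A \<in> BH" "\<And>x. x \<in> K \<Longrightarrow> A x \<in> K" "\<And>x. x \<in> K \<Longrightarrow> op_adj A x \<in> K" for A
  proof (rule blinfun_eqI)
    fix x
    have "P (A x) = A (P x)"
    proof (rule P_eqI)
      show "A (P x) \<in> K" using A(2) PK .
      show "inner (A x - A (P x)) z = 0" if "z \<in> K" for z
        using orth[OF A(3)[OF that], of x] op_adj_inner[OF A(1), of "x - P x" z]
        by (simp add: blinfun.bilinear_simps)
    qed
    then show "(P o\<^sub>L A) x = (A o\<^sub>L P) x" by simp
  qed
  show thesis
  proof (rule that[OF BH adj _ _ commute])
    show "P o\<^sub>L P = P" by (rule blinfun_eqI) (simp add: P_id PK)
    show "range P = K" using PK P_id[symmetric] by blast
  qed
qed

interpretation blinfun_compose: bounded_bilinear "(o\<^sub>L)"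
  by (rule bounded_bilinear_blinfun_compose)

lemma blinfun_compose_id [simp]: "id_blinfun o\<^sub>L T = T" "T o\<^sub>L id_blinfun = T"
  by (auto intro: blinfun_eqI)

lemma blinfun_compose_assoc: "(A o\<^sub>L B) o\<^sub>L C = A o\<^sub>L (B o\<^sub>L C)"
  by (auto intro: blinfun_eqI)

lemma inner_eqI: "(\<And>x. inner x y = inner x z) \<Longrightarrow> y = z"
  for y z :: "'a::real_inner"
  using vector_eq_ldot by blast

lemma op_scale_of_real: "op_scale (complex_of_real r) T = r *\<^sub>R T"
  by (rule blinfun_eqI) (simp add: op_scale_apply scaleC_of_real blinfun.bilinear_simps)

lemma norm_op_adj_le:
  assumes "T \<in> BH" shows "norm (op_adj T) \<le> norm T"
proof (rule norm_blinfun_bound)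
  fix x
  let ?y = "op_adj T x"
  have "(norm ?y)\<^sup>2 = inner (T ?y) x"
    by (simp add: op_adj_inner[OF assms] power2_norm_eq_inner)
  also have "\<dots> \<le> norm (T ?y) * norm x" by (rule norm_cauchy_schwarz)
  also have "\<dots> \<le> (norm T * norm ?y) * norm x"
    by (intro mult_right_mono norm_blinfun) auto
  finally show "norm ?y \<le> norm T * norm x"
    by (cases "?y = 0") (simp_all add: power2_eq_square mult_ac)
qed simp

locale vN_algebra =
  fixes M :: "('a::complex_hilbert_space \<Rightarrow>\<^sub>L 'a) set"
  assumes vN: "von_neumann_algebra M"
begin

lemma M_BH [simp]: "T \<in> M \<Longrightarrow> T \<in> BH"
  and id_M [simp, intro]: "id_blinfun \<in> M"
  and add_M [simp, intro]: "S \<in> M \<Longrightarrow> T \<in> M \<Longrightarrow> S + T \<in> M"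
  and op_scale_M [simp, intro]: "T \<in> M \<Longrightarrow> op_scale c T \<in> M"
  and comp_M [simp, intro]: "S \<in> M \<Longrightarrow> T \<in> M \<Longrightarrow> S o\<^sub>L T \<in> M"
  and adj_M [simp, intro]: "T \<in> M \<Longrightarrow> op_adj T \<in> M"
  using vN by (auto simp: von_neumann_algebra_def)

text \<open>The double commutant condition, through which projections onto subspaces and strong
  limits are shown to belong to \<open>M\<close>.\<close>

lemma in_M_I:
  assumes "T \<in> BH" "\<And>A. A \<in> commutant M \<Longrightarrow> T o\<^sub>L A = A o\<^sub>L T"
  shows "T \<in> M"
  using vN assms by (auto simp: von_neumann_algebra_def commutant_def)

lemma scaleR_M [simp, intro]: "T \<in> M \<Longrightarrow> r *\<^sub>R T \<in> M"
  using op_scale_M[of T "complex_of_real r"] by (simp add: op_scale_of_real)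

lemma uminus_M [simp, intro]: "T \<in> M \<Longrightarrow> - T \<in> M"
  using scaleR_M[of T "-1"] by simp

lemma diff_M [simp, intro]: "S \<in> M \<Longrightarrow> T \<in> M \<Longrightarrow> S - T \<in> M"
  using add_M[of S "- T"] by simp

lemma zero_M [simp, intro]: "0 \<in> M"
  using scaleR_M[OF id_M, of 0] by simp

lemma M_scaleC: "T \<in> M \<Longrightarrow> T (c *\<^sub>C x) = c *\<^sub>C T x"
  using M_BH by (auto simp: BH_def)

lemma adj_inner: "T \<in> M \<Longrightarrow> inner (T x) y = inner x (op_adj T y)"
  by (simp add: op_adj_inner)

lemma adj_inner': "T \<in> M \<Longrightarrow> inner (op_adj T x) y = inner x (T y)"
  by (simp add: op_adj_inner')

lemma adjI: "T \<in> M \<Longrightarrow> (\<And>x y. inner (T x) y = inner x (blinfun_apply S y)) \<Longrightarrow> op_adj T = S"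
  by (rule op_adjI) auto

lemma adj_adj [simp]: "T \<in> M \<Longrightarrow> op_adj (op_adj T) = T"
  by (rule adjI) (auto simp: adj_inner')

lemma adj_comp [simp]: "S \<in> M \<Longrightarrow> T \<in> M \<Longrightarrow> op_adj (S o\<^sub>L T) = op_adj T o\<^sub>L op_adj S"
  by (rule adjI) (auto simp: adj_inner)

lemma adj_add [simp]: "S \<in> M \<Longrightarrow> T \<in> M \<Longrightarrow> op_adj (S + T) = op_adj S + op_adj T"
  by (rule adjI) (auto simp: adj_inner blinfun.bilinear_simps inner_add_left inner_add_right)

lemma adj_diff [simp]: "S \<in> M \<Longrightarrow> T \<in> M \<Longrightarrow> op_adj (S - T) = op_adj S - op_adj T"
  by (rule adjI) (auto simp: adj_inner blinfun.bilinear_simps inner_diff_left inner_diff_right)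

lemma adj_id [simp]: "op_adj (id_blinfun :: 'a \<Rightarrow>\<^sub>L 'a) = id_blinfun"
  by (rule adjI) auto

lemma adj_scaleR [simp]: "T \<in> M \<Longrightarrow> op_adj (r *\<^sub>R T) = r *\<^sub>R op_adj T"
  by (rule adjI) (auto simp: adj_inner blinfun.bilinear_simps)

lemma adj_op_scale [simp]: "T \<in> M \<Longrightarrow> op_adj (op_scale c T) = op_scale (cnj c) (op_adj T)"
  by (rule adjI) (auto simp: adj_inner op_scale_apply inner_scaleC_left M_scaleC[OF adj_M])

lemma norm_adj [simp]: "T \<in> M \<Longrightarrow> norm (op_adj T) = norm T"
  using norm_op_adj_le[of T] norm_op_adj_le[of "op_adj T"] by simp

lemma norm_square_adj: "T \<in> M \<Longrightarrow> (norm (T x))\<^sup>2 = inner (op_adj T (T x)) x"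
  by (simp add: adj_inner' power2_norm_eq_inner)

lemma commutant_adj: "A \<in> commutant M \<Longrightarrow> op_adj A \<in> commutant M"
proof -
  assume A: "A \<in> commutant M"
  then have ABH: "A \<in> BH" and com: "\<And>T. T \<in> M \<Longrightarrow> A o\<^sub>L T = T o\<^sub>L A" by (auto simp: commutant_def)
  have "op_adj A (c *\<^sub>C y) = c *\<^sub>C op_adj A y" for c y
  proof -
    have "inner x (op_adj A (c *\<^sub>C y)) = inner x (c *\<^sub>C op_adj A y)" for x
    proof -
      have "inner x (op_adj A (c *\<^sub>C y)) = inner (cnj c *\<^sub>C A x) y"
        by (simp add: op_adj_inner[OF ABH, symmetric] inner_scaleC_left)
      also have "\<dots> = inner (A (cnj c *\<^sub>C x)) y" using ABH by (simp add: BH_def)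
      also have "\<dots> = inner x (c *\<^sub>C op_adj A y)"
        by (simp add: op_adj_inner[OF ABH] inner_scaleC_left)
      finally show ?thesis .
    qed
    then show ?thesis by (rule inner_eqI)
  qed
  then have "op_adj A \<in> BH" by (simp add: BH_def)
  moreover have "op_adj A o\<^sub>L T = T o\<^sub>L op_adj A" if T: "T \<in> M" for T
  proof (rule blinfun_eqI)
    fix y
    have "inner x (op_adj A (T y)) = inner x (T (op_adj A y))" for x
    proof -
      have "inner x (op_adj A (T y)) = inner (op_adj T (A x)) y"
        by (simp add: op_adj_inner[OF ABH, symmetric] adj_inner' T)
      also have "op_adj T (A x) = A (op_adj T x)"
        using arg_cong[OF com[OF adj_M[OF T]], of "\<lambda>B. blinfun_apply B x"] by simp
      also have "inner (A (op_adj T x)) y = inner x (T (op_adj A y))"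
        by (simp add: op_adj_inner[OF ABH] adj_inner' T)
      finally show ?thesis .
    qed
    then have "op_adj A (T y) = T (op_adj A y)" by (rule inner_eqI)
    then show "(op_adj A o\<^sub>L T) y = (T o\<^sub>L op_adj A) y" by simp
  qed
  ultimately show ?thesis by (simp add: commutant_def)
qed

lemma commutant_apply: "A \<in> commutant M \<Longrightarrow> T \<in> M \<Longrightarrow> A (T x) = T (A x)"
proof -
  assume "A \<in> commutant M" "T \<in> M"
  then have "A o\<^sub>L T = T o\<^sub>L A" by (simp add: commutant_def)
  from arg_cong[OF this, of "\<lambda>B. blinfun_apply B x"] show ?thesis by simp
qed

text \<open>The commutant is closed under adjoints (\<open>commutant_adj\<close>), so the projection
  onto an invariant subspace commutes with all of it and lies in the double commutant.\<close>

lemma projection_onto: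
  assumes "closed K" "subspace K" "\<And>c x. x \<in> K \<Longrightarrow> c *\<^sub>C x \<in> K"
    and "\<And>A x. A \<in> commutant M \<Longrightarrow> x \<in> K \<Longrightarrow> A x \<in> K"
  obtains P where "P \<in> projections M" "range P = K"
proof -
  obtain P :: "'a \<Rightarrow>\<^sub>L 'a" where P: "P \<in> BH" "op_adj P = P" "P o\<^sub>L P = P" "range P = K"
    and com: "\<And>A. A \<in> BH \<Longrightarrow> (\<And>x. x \<in> K \<Longrightarrow> A x \<in> K) \<Longrightarrow> (\<And>x. x \<in> K \<Longrightarrow> op_adj A x \<in> K) \<Longrightarrow> P o\<^sub>L A = A o\<^sub>L P"
    using complex_subspace_projection[OF assms(2,3,1)] by blast
  have "P \<in> M"
  proof (rule in_M_I[OF P(1)])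
    fix A assume A: "A \<in> commutant M"
    show "P o\<^sub>L A = A o\<^sub>L P"
      by (rule com) (use A assms(4) commutant_adj in \<open>auto simp: commutant_def\<close>)
  qed
  then show thesis using that P by (auto simp: projections_def)
qed

text \<open>Complex linearity and commutation with a fixed bounded operator survive pointwise
  limits. This covers operators defined by strongly convergent series.\<close>

lemma strong_limit_M:
  fixes T :: "'a \<Rightarrow>\<^sub>L 'a"
  assumes "\<And>n. F n \<in> M" "\<And>x. (\<lambda>n. F n x) \<longlonglongrightarrow> T x"
  shows "T \<in> M"
proof (rule in_M_I)
  have "T (c *\<^sub>C x) = c *\<^sub>C T x" for c x
  proof (rule LIMSEQ_unique[OF assms(2)])
    have bl: "bounded_linear ((*\<^sub>C) c :: 'a \<Rightarrow> 'a)"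
      using blinfun.bounded_linear_right[of "op_scale c id_blinfun"] by (simp add: op_scale_apply)
    have "(\<lambda>n. c *\<^sub>C F n x) \<longlonglongrightarrow> c *\<^sub>C T x"
      by (rule bounded_linear.tendsto[OF bl assms(2)])
    then show "(\<lambda>n. F n (c *\<^sub>C x)) \<longlonglongrightarrow> c *\<^sub>C T x"
      using assms(1) by (simp add: M_scaleC)
  qed
  then show "T \<in> BH" by (simp add: BH_def)
  fix A assume A: "A \<in> commutant M"
  show "T o\<^sub>L A = A o\<^sub>L T"
  proof (rule blinfun_eqI)
    fix x
    have "(\<lambda>n. A (F n x)) \<longlonglongrightarrow> A (T x)" by (intro tendsto_intros assms)
    moreover have "(\<lambda>n. A (F n x)) \<longlonglongrightarrow> T (A x)"
      using assms(2)[of "A x"] commutant_apply[OF A assms(1)] by simp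
    ultimately show "(T o\<^sub>L A) x = (A o\<^sub>L T) x" by (simp add: LIMSEQ_unique)
  qed
qed

lemma closed_M: "closed M"
  unfolding closed_sequential_limits
proof (intro allI impI, elim conjE)
  fix F T assume F: "\<forall>n. F n \<in> M" "F \<longlonglongrightarrow> T"
  show "T \<in> M"
    by (rule strong_limit_M[of F]) (use F in \<open>auto intro!: tendsto_intros\<close>)
qed

text \<open>The inverse is the fixed point of a contraction of the complete set \<open>M\<close>, so
  it lies in \<open>M\<close> automatically. The maps \<open>id_blinfun + (X o\<^sub>L Z)\<close>
  and \<open>id_blinfun + (Z o\<^sub>L X)\<close> give a right and a left inverse, which agree by
  associativity.\<close>

lemma neumann_inverse:
  assumes X: "X \<in> M" "norm X < 1"
  obtains Z where "Z \<in> M" "(id_blinfun - X) o\<^sub>L Z = id_blinfun" "Z o\<^sub>L (id_blinfun - X) = id_blinfun"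
proof -
  have cM: "complete M" "M \<noteq> {}" using closed_M by (auto simp: complete_eq_closed)
  have l: "dist (id_blinfun + (X o\<^sub>L Y)) (id_blinfun + (X o\<^sub>L Z)) \<le> norm X * dist Y Z" for Y Z
    using norm_blinfun_compose[of X "Y - Z"]
    by (simp add: dist_norm blinfun_compose.diff_right)
  have r: "dist (id_blinfun + (Y o\<^sub>L X)) (id_blinfun + (Z o\<^sub>L X)) \<le> norm X * dist Y Z" for Y Z
    using norm_blinfun_compose[of "Y - Z" X]
    by (simp add: dist_norm blinfun_compose.diff_left mult.commute)
  have "\<exists>!Z. Z \<in> M \<and> id_blinfun + (X o\<^sub>L Z) = Z"
    by (rule Banach_fix[OF cM, of "norm X"]) (use X l in auto)
  then obtain Z where Z: "Z \<in> M" "id_blinfun + (X o\<^sub>L Z) = Z" by blast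
  have "\<exists>!Z. Z \<in> M \<and> id_blinfun + (Z o\<^sub>L X) = Z"
    by (rule Banach_fix[OF cM, of "norm X"]) (use X r in auto)
  then obtain Y where Y: "Y \<in> M" "id_blinfun + (Y o\<^sub>L X) = Y" by blast
  have ZX: "(id_blinfun - X) o\<^sub>L Z = id_blinfun"
    using Z(2) by (simp add: blinfun_compose.diff_left algebra_simps)
  have YX: "Y o\<^sub>L (id_blinfun - X) = id_blinfun"
    using Y(2) by (simp add: blinfun_compose.diff_right algebra_simps)
  have "Y o\<^sub>L ((id_blinfun - X) o\<^sub>L Z) = (Y o\<^sub>L (id_blinfun - X)) o\<^sub>L Z"
    by (simp only: blinfun_compose_assoc)
  then have "Y = Z" by (simp add: ZX YX)
  then show thesis using that Z(1) ZX YX by blast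
qed

end

section \<open>Square roots and inverses\<close>

lemma norm_compose_le:
  fixes S T :: "'a::real_normed_vector \<Rightarrow>\<^sub>L 'a"
  assumes "norm S \<le> s" "norm T \<le> t"
  shows "norm (S o\<^sub>L T) \<le> s * t"
proof -
  have "norm (S o\<^sub>L T) \<le> norm S * norm T" by (rule norm_blinfun_compose)
  also have "\<dots> \<le> s * t"
    using assms by (intro mult_mono) (auto intro: order_trans[OF norm_ge_zero])
  finally show ?thesis .
qed

text \<open>The limit \<open>Y\<close> satisfies \<open>(1 - Y)\<^sup>2 = 1 - X\<close>.\<close>

primrec sqrt_iter :: "('a \<Rightarrow>\<^sub>L 'a) \<Rightarrow> nat \<Rightarrow> ('a::real_normed_vector \<Rightarrow>\<^sub>L 'a)" where
  "sqrt_iter X 0 = 0"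
| "sqrt_iter X (Suc n) = (1/2) *\<^sub>R (X + (sqrt_iter X n o\<^sub>L sqrt_iter X n))"

primrec sqrt_iter_real :: "nat \<Rightarrow> real" where
  "sqrt_iter_real 0 = 0"
| "sqrt_iter_real (Suc n) = (1 + (sqrt_iter_real n)\<^sup>2) / 2"

lemma sqrt_iter_real_bounds: "0 \<le> sqrt_iter_real n" "sqrt_iter_real n \<le> 1"
proof (induction n)
  case (Suc n)
  have "(sqrt_iter_real n)\<^sup>2 \<le> 1\<^sup>2"
    by (rule power_mono) (use Suc in auto)
  then show "sqrt_iter_real (Suc n) \<le> 1" by simp
qed auto

lemma sqrt_iter_real_mono: "incseq sqrt_iter_real"
proof (rule incseq_SucI)
  fix n
  have "0 \<le> (1 - sqrt_iter_real n)\<^sup>2" by simp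
  then show "sqrt_iter_real n \<le> sqrt_iter_real (Suc n)"
    by (simp add: power2_eq_square algebra_simps)
qed

text \<open>Comparison with the scalar iteration for the argument 1 gives norm convergence up to and
  including \<open>\<parallel>X\<parallel> = 1\<close>, where the iteration is no longer a strict contraction.\<close>

lemma norm_sqrt_iter:
  assumes "norm X \<le> 1"
  shows "norm (sqrt_iter X n) \<le> sqrt_iter_real n"
proof (induction n)
  case (Suc n)
  have "norm (sqrt_iter X (Suc n)) \<le> (norm X + norm (sqrt_iter X n o\<^sub>L sqrt_iter X n)) / 2"
    using norm_triangle_ineq by simp
  also have "\<dots> \<le> sqrt_iter_real (Suc n)"
    using assms norm_compose_le[OF Suc Suc] by (simp add: power2_eq_square)
  finally show ?case .
qed simp

text \<open>A difference of squares splits as \<open>Y (Y - Z) + (Y - Z) Z\<close> without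
  commutativity, and the resulting bound \<open>(y - z) (y + z) / 2\<close> is exactly the next
  scalar increment.\<close>

lemma norm_sqrt_iter_step:
  assumes "norm X \<le> 1"
  shows "norm (sqrt_iter X (Suc n) - sqrt_iter X n) \<le> sqrt_iter_real (Suc n) - sqrt_iter_real n"
proof (induction n)
  case 0
  then show ?case using assms by simp
next
  case (Suc n)
  let ?Y = "sqrt_iter X (Suc n)" and ?Z = "sqrt_iter X n"
  let ?y = "sqrt_iter_real (Suc n)" and ?z = "sqrt_iter_real n"
  have "sqrt_iter X (Suc (Suc n)) - ?Y = (1/2) *\<^sub>R ((?Y o\<^sub>L ?Y) - (?Z o\<^sub>L ?Z))"
    unfolding sqrt_iter.simps(2)[of X "Suc n"]
    by (subst (3) sqrt_iter.simps(2)) (simp only: scaleR_diff_right[symmetric] add_diff_cancel_left)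
  also have "(?Y o\<^sub>L ?Y) - (?Z o\<^sub>L ?Z) = (?Y o\<^sub>L (?Y - ?Z)) + ((?Y - ?Z) o\<^sub>L ?Z)"
    by (simp only: blinfun_compose.diff_left blinfun_compose.diff_right) simp
  finally have "norm (sqrt_iter X (Suc (Suc n)) - ?Y)
      \<le> (norm (?Y o\<^sub>L (?Y - ?Z)) + norm ((?Y - ?Z) o\<^sub>L ?Z)) / 2"
    using norm_triangle_ineq by simp
  also have "\<dots> \<le> (?y * (?y - ?z) + (?y - ?z) * ?z) / 2"
    by (intro divide_right_mono add_mono norm_compose_le norm_sqrt_iter assms Suc) simp
  also have "\<dots> = sqrt_iter_real (Suc (Suc n)) - ?y"
  proof -
    have "(y * (y - z) + (y - z) * z) / 2 = (1 + y\<^sup>2) / 2 - y" if "z\<^sup>2 = 2 * y - 1" for y z :: real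
      using that by (simp add: power2_eq_square field_simps)
    moreover have "?z\<^sup>2 = 2 * ?y - 1" by (simp add: field_simps)
    ultimately show ?thesis unfolding sqrt_iter_real.simps(2)[of "Suc n"] by blast
  qed
  finally show ?case .
qed

text \<open>By telescoping, distances between iterates are dominated by those of the scalar
  sequence, which is increasing and bounded, hence Cauchy.\<close>

lemma sqrt_iter_convergent:
  fixes X :: "'a::banach \<Rightarrow>\<^sub>L 'a"
  assumes "norm X \<le> 1"
  shows "convergent (sqrt_iter X)"
proof -
  have diff: "norm (sqrt_iter X (n + k) - sqrt_iter X n) \<le> sqrt_iter_real (n + k) - sqrt_iter_real n"
    for n k
  proof (induction k)
    case (Suc k)
    have "norm (sqrt_iter X (n + Suc k) - sqrt_iter X n)
        \<le> norm (sqrt_iter X (Suc (n + k)) - sqrt_iter X (n + k)) + norm (sqrt_iter X (n + k) - sqrt_iter X n)"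
      using norm_triangle_ineq[of "sqrt_iter X (Suc (n + k)) - sqrt_iter X (n + k)" "sqrt_iter X (n + k) - sqrt_iter X n"]
      by (simp del: sqrt_iter.simps)
    then show ?case using Suc norm_sqrt_iter_step[OF assms, of "n + k"] by simp
  qed simp
  have "convergent sqrt_iter_real"
    using sqrt_iter_real_mono incseq_convergent[of sqrt_iter_real 1] sqrt_iter_real_bounds
    by (metis convergent_def)
  then have C: "Cauchy sqrt_iter_real" by (rule convergent_Cauchy)
  have le: "dist (sqrt_iter X m) (sqrt_iter X n) \<le> dist (sqrt_iter_real m) (sqrt_iter_real n)" for m n
  proof (cases "m \<le> n")
    case True
    with diff[of m "n - m"] show ?thesis by (simp add: dist_norm norm_minus_commute)
  next
    case False
    with diff[of n "m - n"] show ?thesis by (simp add: dist_norm)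
  qed
  have "Cauchy (sqrt_iter X)"
    using C le unfolding Cauchy_def by (meson order_le_less_trans)
  then show ?thesis by (rule Cauchy_convergent)
qed

context vN_algebra
begin

text \<open>The root is \<open>id_blinfun - Y\<close> with \<open>Y\<close> the limit of the
  iteration. It is positive because \<open>norm Y \<le> 1\<close>, and it commutes with whatever
  commutes with \<open>X\<close> because every iterate is a polynomial in \<open>X\<close>.\<close>

lemma sqrt_id_minus:
  assumes X: "X \<in> M" "op_adj X = X" "norm X \<le> 1"
  obtains R where "R \<in> M" "op_adj R = R" "R o\<^sub>L R = id_blinfun - X"
    "\<And>x. inner (R x) x \<ge> 0" "\<And>A. A o\<^sub>L X = X o\<^sub>L A \<Longrightarrow> A o\<^sub>L R = R o\<^sub>L A"
proof -
  let ?Y = "sqrt_iter X"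
  obtain Y where Y: "?Y \<longlonglongrightarrow> Y" using sqrt_iter_convergent[OF X(3)] convergent_def by blast
  have inM: "?Y n \<in> M" for n by (induction n) (auto simp: X)
  have sa: "op_adj (?Y n) = ?Y n" for n
    by (induction n) (auto simp: X inM intro: adjI[OF zero_M])
  have com: "A o\<^sub>L ?Y n = ?Y n o\<^sub>L A" if "A o\<^sub>L X = X o\<^sub>L A" for A n
  proof (induction n)
    case (Suc n)
    have "A o\<^sub>L (?Y n o\<^sub>L ?Y n) = (?Y n o\<^sub>L ?Y n) o\<^sub>L A"
      by (metis Suc blinfun_compose_assoc)
    then show ?case
      by (simp add: that blinfun_compose.scaleR_left blinfun_compose.scaleR_right
          blinfun_compose.add_left blinfun_compose.add_right)
  qed simp
  have YM: "Y \<in> M" using closed_sequentially[OF closed_M inM Y] .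
  have Yap: "(\<lambda>n. ?Y n x) \<longlonglongrightarrow> Y x" for x by (intro tendsto_intros Y)
  have Ysa: "op_adj Y = Y"
  proof (rule adjI[OF YM])
    fix x y
    have "(\<lambda>n. inner (?Y n x) y) \<longlonglongrightarrow> inner (Y x) y"
      "(\<lambda>n. inner x (?Y n y)) \<longlonglongrightarrow> inner x (Y y)"
      by (intro tendsto_inner tendsto_const Yap)+
    then show "inner (Y x) y = inner x (Y y)"
      by (simp add: adj_inner[OF inM] sa LIMSEQ_unique)
  qed
  have Yn: "norm Y \<le> 1"
    using Lim_bounded[OF tendsto_norm[OF Y], of 0 1] norm_sqrt_iter[OF X(3)] sqrt_iter_real_bounds(2)
    by (meson order_trans)
  have Yeq: "Y = (1/2) *\<^sub>R (X + (Y o\<^sub>L Y))"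
  proof (rule LIMSEQ_unique)
    show "(\<lambda>n. ?Y (Suc n)) \<longlonglongrightarrow> Y" by (rule LIMSEQ_Suc[OF Y])
    show "(\<lambda>n. ?Y (Suc n)) \<longlonglongrightarrow> (1/2) *\<^sub>R (X + (Y o\<^sub>L Y))"
      unfolding sqrt_iter.simps by (intro tendsto_intros Y)
  qed
  have Ycom: "A o\<^sub>L Y = Y o\<^sub>L A" if "A o\<^sub>L X = X o\<^sub>L A" for A
  proof (rule LIMSEQ_unique)
    show "(\<lambda>n. A o\<^sub>L ?Y n) \<longlonglongrightarrow> (A o\<^sub>L Y)" by (intro tendsto_intros Y)
    show "(\<lambda>n. A o\<^sub>L ?Y n) \<longlonglongrightarrow> (Y o\<^sub>L A)"
      unfolding com[OF that] by (intro tendsto_intros Y)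
  qed
  show thesis
  proof (rule that[of "id_blinfun - Y"])
    show "id_blinfun - Y \<in> M" using YM by simp
    show "op_adj (id_blinfun - Y) = id_blinfun - Y" using YM by (simp add: Ysa)
    have "2 *\<^sub>R Y = X + (Y o\<^sub>L Y)" by (subst Yeq) simp
    then have "Y + Y = X + (Y o\<^sub>L Y)" by (simp add: scaleR_2)
    then show "(id_blinfun - Y) o\<^sub>L (id_blinfun - Y) = id_blinfun - X"
      by (simp add: blinfun_compose.diff_left blinfun_compose.diff_right algebra_simps)
    show "inner ((id_blinfun - Y) x) x \<ge> 0" for x
    proof -
      have "inner (Y x) x \<le> norm (Y x) * norm x" by (rule norm_cauchy_schwarz)
      also have "\<dots> \<le> (norm Y * norm x) * norm x" by (intro mult_right_mono norm_blinfun) simp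
      also have "\<dots> \<le> (1 * norm x) * norm x" by (intro mult_right_mono Yn) auto
      finally show ?thesis
        by (simp add: blinfun.bilinear_simps inner_diff_left power2_norm_eq_inner[symmetric] power2_eq_square)
    qed
    show "A o\<^sub>L (id_blinfun - Y) = (id_blinfun - Y) o\<^sub>L A" if "A o\<^sub>L X = X o\<^sub>L A" for A
      using Ycom[OF that] by (simp add: blinfun_compose.diff_left blinfun_compose.diff_right)
  qed
qed

text \<open>After expanding the square, the quadratic term is absorbed by half of the linear one.
  For \<open>t > 0\<close> and \<open>V\<close> bounded below, the remaining gain
  \<open>t * (norm (V x))\<^sup>2\<close> yields a strict contraction.\<close>

lemma norm_id_minus_square:
  assumes V: "V \<in> M" "t \<ge> 0" "t * (norm V)\<^sup>2 \<le> 1"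
  shows "(norm (x - t *\<^sub>R op_adj V (V x)))\<^sup>2 \<le> (norm x)\<^sup>2 - t * (norm (V x))\<^sup>2"
proof -
  have "(norm (op_adj V (V x)))\<^sup>2 \<le> (norm V * norm (V x))\<^sup>2"
    using norm_blinfun[of "op_adj V" "V x"] V by (intro power_mono) auto
  then have "t\<^sup>2 * (norm (op_adj V (V x)))\<^sup>2 \<le> t\<^sup>2 * ((norm V)\<^sup>2 * (norm (V x))\<^sup>2)"
    by (intro mult_left_mono) (auto simp: power_mult_distrib)
  also have "\<dots> = t * (norm (V x))\<^sup>2 * (t * (norm V)\<^sup>2)"
    by (simp add: power2_eq_square mult_ac)
  also have "\<dots> \<le> t * (norm (V x))\<^sup>2 * 1"
    using V by (intro mult_left_mono) auto
  finally have "t\<^sup>2 * (norm (op_adj V (V x)))\<^sup>2 \<le> t * (norm (V x))\<^sup>2" by simp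
  moreover have "(norm (x - t *\<^sub>R op_adj V (V x)))\<^sup>2
      = (norm x)\<^sup>2 - 2 * t * (norm (V x))\<^sup>2 + t\<^sup>2 * (norm (op_adj V (V x)))\<^sup>2"
    unfolding power2_norm_eq_inner
    by (simp add: inner_diff_left inner_diff_right adj_inner[OF V(1), symmetric] adj_inner'[OF V(1)]
        blinfun.diff_right blinfun.scaleR_right power2_eq_square algebra_simps)
  ultimately show ?thesis by simp
qed

text \<open>\<open>R\<close> is the absolute value of \<open>V\<close>, obtained from
  \<open>sqrt_id_minus\<close> by rescaling.\<close>

lemma abs_exists:
  assumes V: "V \<in> M"
  obtains R where "R \<in> M" "op_adj R = R" "R o\<^sub>L R = op_adj V o\<^sub>L V"
    "\<And>x. inner (R x) x \<ge> 0"
    "\<And>A. A o\<^sub>L (op_adj V o\<^sub>L V) = (op_adj V o\<^sub>L V) o\<^sub>L A \<Longrightarrow> A o\<^sub>L R = R o\<^sub>L A"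
proof (cases "V = 0")
  case True
  have "op_adj 0 = (0 :: 'a \<Rightarrow>\<^sub>L 'a)" by (rule adjI) auto
  then show thesis using that[of 0] True by simp
next
  case False
  define t where "t = 1 / (norm V)\<^sup>2"
  have t: "t > 0" "t * (norm V)\<^sup>2 = 1" using False by (auto simp: t_def)
  let ?H = "op_adj V o\<^sub>L V"
  \<comment> \<open>Chosen so that \<open>id_blinfun - ?X\<close> is \<open>?H\<close> divided by
    the square of \<open>norm V\<close>; its root is multiplied by \<open>norm V\<close> at the
    end.\<close>
  let ?X = "id_blinfun - t *\<^sub>R ?H"
  have HM: "?H \<in> M" using V by simp
  have n: "norm ?X \<le> 1"
  proof (rule norm_blinfun_bound)
    fix x
    have "(norm (x - t *\<^sub>R op_adj V (V x)))\<^sup>2 \<le> (norm x)\<^sup>2"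
      using norm_id_minus_square[OF V less_imp_le[OF t(1)] eq_refl[OF t(2)], of x]
        mult_nonneg_nonneg[OF less_imp_le[OF t(1)] zero_le_power2[of "norm (V x)"]] by linarith
    from power2_le_imp_le[OF this] show "norm (?X x) \<le> 1 * norm x"
      by (simp add: blinfun.bilinear_simps)
  qed simp
  have XM: "?X \<in> M" using HM by simp
  have sa: "op_adj ?X = ?X" using V by simp
  obtain R where R: "R \<in> M" "op_adj R = R" "R o\<^sub>L R = id_blinfun - ?X" "\<And>x. inner (R x) x \<ge> 0"
    "\<And>A. A o\<^sub>L ?X = ?X o\<^sub>L A \<Longrightarrow> A o\<^sub>L R = R o\<^sub>L A"
    using sqrt_id_minus[OF XM sa n] by blast
  show thesis
  proof (rule that[of "norm V *\<^sub>R R"])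
    show "norm V *\<^sub>R R \<in> M" using R(1) by simp
    show "op_adj (norm V *\<^sub>R R) = norm V *\<^sub>R R" using R(1,2) by simp
    show "inner ((norm V *\<^sub>R R) x) x \<ge> 0" for x
      using R(4)[of x] by (simp add: blinfun.bilinear_simps)
    have "(norm V *\<^sub>R R) o\<^sub>L (norm V *\<^sub>R R) = (norm V)\<^sup>2 *\<^sub>R (R o\<^sub>L R)"
      by (simp add: blinfun_compose.scaleR_left blinfun_compose.scaleR_right power2_eq_square)
    also have "\<dots> = ?H" using t(2) by (simp add: R(3) mult.commute)
    finally show "(norm V *\<^sub>R R) o\<^sub>L (norm V *\<^sub>R R) = ?H" .
    show "A o\<^sub>L (norm V *\<^sub>R R) = (norm V *\<^sub>R R) o\<^sub>L A" if "A o\<^sub>L ?H = ?H o\<^sub>L A" for A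
    proof -
      have "A o\<^sub>L ?X = ?X o\<^sub>L A"
        using that by (simp add: blinfun_compose.diff_left blinfun_compose.diff_right
            blinfun_compose.scaleR_left blinfun_compose.scaleR_right)
      from R(5)[OF this] show ?thesis
        by (simp add: blinfun_compose.scaleR_left blinfun_compose.scaleR_right)
    qed
  qed
qed

text \<open>\<open>op_adj S o\<^sub>L S\<close> is inverted by \<open>neumann_inverse\<close> and
  its inverse is composed with \<open>op_adj S\<close>. The norm bound comes from a projection
  argument, not from an estimate of that inverse.\<close>

lemma left_inverse_bounded_below:
  assumes S: "S \<in> M" "d > 0" "\<And>x. d * norm x \<le> norm (S x)"
  obtains A where "A \<in> M" "A o\<^sub>L S = id_blinfun" "norm A \<le> 1 / d"
proof -
  \<comment> \<open>The summand \<open>d\<^sup>2\<close> secures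
    \<open>t * d\<^sup>2 \<le> 1\<close> without comparing \<open>d\<close> with
    \<open>norm S\<close>, which may be smaller than \<open>d\<close> on the zero space.\<close>
  define t where "t = 1 / ((norm S)\<^sup>2 + d\<^sup>2)"
  have pos: "(norm S)\<^sup>2 + d\<^sup>2 > 0" using S(2) by (simp add: add_nonneg_pos)
  have t: "t > 0" "t * (norm S)\<^sup>2 \<le> 1" "t * d\<^sup>2 \<le> 1"
    using pos by (auto simp: t_def)
  let ?X = "id_blinfun - t *\<^sub>R (op_adj S o\<^sub>L S)"
  have "norm ?X \<le> sqrt (1 - t * d\<^sup>2)"
  proof (rule norm_blinfun_bound)
    fix x
    have "(d * norm x)\<^sup>2 \<le> (norm (S x))\<^sup>2" using S(2,3) by (intro power_mono) auto
    then have "t * (d\<^sup>2 * (norm x)\<^sup>2) \<le> t * (norm (S x))\<^sup>2"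
      using t(1) by (intro mult_left_mono) (auto simp: power_mult_distrib)
    then have "(norm (x - t *\<^sub>R op_adj S (S x)))\<^sup>2 \<le> (1 - t * d\<^sup>2) * (norm x)\<^sup>2"
      using norm_id_minus_square[OF S(1), of t x] t unfolding left_diff_distrib by linarith
    from real_sqrt_le_mono[OF this] show "norm (?X x) \<le> sqrt (1 - t * d\<^sup>2) * norm x"
      by (simp add: blinfun.bilinear_simps real_sqrt_mult)
  qed (use t in simp)
  also have "\<dots> < 1" using t S(2) by simp
  finally have n: "norm ?X < 1" .
  have XM: "?X \<in> M" using S(1) by simp
  obtain Z where Z: "Z \<in> M" "t *\<^sub>R (op_adj S o\<^sub>L S) o\<^sub>L Z = id_blinfun"
    "Z o\<^sub>L t *\<^sub>R (op_adj S o\<^sub>L S) = id_blinfun"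
    using neumann_inverse[OF XM n] by auto
  let ?A = "t *\<^sub>R (Z o\<^sub>L op_adj S)"
  show thesis
  proof (rule that)
    show "?A \<in> M" using Z S by simp
    show "?A o\<^sub>L S = id_blinfun"
      using Z(3) by (simp add: blinfun_compose.scaleR_left blinfun_compose.scaleR_right blinfun_compose_assoc)
    show "norm ?A \<le> 1 / d"
    proof (rule norm_blinfun_bound)
      fix y
      let ?z = "?A y"
      \<comment> \<open>This says that \<open>S ?z\<close> is the orthogonal projection of
        \<open>y\<close> onto the range of \<open>S\<close>, hence no longer than
        \<open>y\<close>.\<close>
      have "op_adj S (S ?z) = op_adj S y"
        using arg_cong[OF Z(2), of "\<lambda>B. blinfun_apply B (op_adj S y)"] by (simp add: blinfun.bilinear_simps)
      then have "(norm (S ?z))\<^sup>2 = inner (op_adj S y) ?z"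
        by (simp add: norm_square_adj S(1))
      also have "\<dots> = inner y (S ?z)" using S(1) by (rule adj_inner')
      also have "\<dots> \<le> norm y * norm (S ?z)" by (rule norm_cauchy_schwarz)
      finally have "norm (S ?z) \<le> norm y"
        by (cases "S ?z = 0") (simp_all add: power2_eq_square)
      with S(3)[of ?z] have "d * norm ?z \<le> norm y" by linarith
      then show "norm ?z \<le> 1 / d * norm y" using S(2) by (simp add: field_simps)
    qed (use S in simp)
  qed
qed

section \<open>Contractions as means of unitaries\<close>

lemma unitariesI:
  assumes "U \<in> M" "op_adj U o\<^sub>L U = id_blinfun" "U o\<^sub>L op_adj U = id_blinfun"
  shows "U \<in> unitaries M"
  using assms by (simp add: unitaries_def)

lemma unitaries_M: "U \<in> unitaries M \<Longrightarrow> U \<in> M"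
  by (simp add: unitaries_def)

lemma unitaries_id: "id_blinfun \<in> unitaries M"
  by (simp add: unitaries_def)

lemma unitaries_adj: "U \<in> unitaries M \<Longrightarrow> op_adj U \<in> unitaries M"
  by (auto simp: unitaries_def)

lemma unitaries_comp:
  assumes "U \<in> unitaries M" "V \<in> unitaries M"
  shows "U o\<^sub>L V \<in> unitaries M"
proof (rule unitariesI)
  have U: "U \<in> M" "op_adj U o\<^sub>L U = id_blinfun" "U o\<^sub>L op_adj U = id_blinfun"
    and V: "V \<in> M" "op_adj V o\<^sub>L V = id_blinfun" "V o\<^sub>L op_adj V = id_blinfun"
    using assms by (auto simp: unitaries_def)
  show "U o\<^sub>L V \<in> M" using U V by simp
  show "op_adj (U o\<^sub>L V) o\<^sub>L (U o\<^sub>L V) = id_blinfun"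
    using U V blinfun_compose_assoc[of "op_adj U" U V] by (simp add: blinfun_compose_assoc)
  show "(U o\<^sub>L V) o\<^sub>L op_adj (U o\<^sub>L V) = id_blinfun"
    using U V blinfun_compose_assoc[of V "op_adj V" "op_adj U"] by (simp add: blinfun_compose_assoc)
qed

lemma norm_unitary_le: "U \<in> unitaries M \<Longrightarrow> norm U \<le> 1"
proof (rule norm_blinfun_bound)
  assume U: "U \<in> unitaries M"
  fix x
  have "op_adj U (U x) = x"
  proof -
    have "op_adj U o\<^sub>L U = id_blinfun" using U by (simp add: unitaries_def)
    from arg_cong[OF this, of "\<lambda>B. blinfun_apply B x"] show ?thesis by simp
  qed
  then have "(norm (U x))\<^sup>2 = (norm x)\<^sup>2"
    using norm_square_adj[OF unitaries_M[OF U], of x] by (simp add: power2_norm_eq_inner)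
  then show "norm (U x) \<le> 1 * norm x" by simp
qed simp

text \<open>Polar decomposition \<open>V = U R\<close>, where \<open>R\<close> is the mean of the unitaries
  \<open>R \<plusminus> \<i> (1 - R\<^sup>2)\<^sup>1\<^sup>/\<^sup>2\<close>.\<close>

lemma invertible_contraction_sum_unitaries:
  assumes V: "V \<in> M" "norm V \<le> 1" and B: "B \<in> M" "B o\<^sub>L V = id_blinfun" "V o\<^sub>L B = id_blinfun"
  obtains U1 U2 where "U1 \<in> unitaries M" "U2 \<in> unitaries M" "2 *\<^sub>R V = U1 + U2"
proof -
  let ?H = "op_adj V o\<^sub>L V"
  obtain R where R: "R \<in> M" "op_adj R = R" "R o\<^sub>L R = ?H"
    and Rcom: "\<And>A. A o\<^sub>L ?H = ?H o\<^sub>L A \<Longrightarrow> A o\<^sub>L R = R o\<^sub>L A"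
    using abs_exists[OF V(1)] by metis
  have HM: "?H \<in> M" "op_adj ?H = ?H" using V by auto
  have "norm ?H \<le> 1" using norm_compose_le[of "op_adj V" 1 V 1] V by simp
  then obtain Q where Q: "Q \<in> M" "op_adj Q = Q" "Q o\<^sub>L Q = id_blinfun - ?H"
    and Qcom: "\<And>A. A o\<^sub>L ?H = ?H o\<^sub>L A \<Longrightarrow> A o\<^sub>L Q = Q o\<^sub>L A"
    using sqrt_id_minus[OF HM] by metis
  have RQ: "R o\<^sub>L Q = Q o\<^sub>L R" by (rule Qcom) (simp add: R(3)[symmetric] blinfun_compose_assoc)
  have VB': "op_adj B o\<^sub>L op_adj V = id_blinfun" "op_adj V o\<^sub>L op_adj B = id_blinfun"
    using B V by (metis adj_comp adj_id)+
  \<comment> \<open>\<open>B o\<^sub>L op_adj B\<close> inverts \<open>?H\<close>, the square of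
    \<open>R\<close>, so this is the candidate for the inverse of \<open>R\<close>.\<close>
  let ?Ri = "R o\<^sub>L (B o\<^sub>L op_adj B)"
  have H_inv: "?H o\<^sub>L (B o\<^sub>L op_adj B) = id_blinfun" "(B o\<^sub>L op_adj B) o\<^sub>L ?H = id_blinfun"
    using B VB' by (metis blinfun_compose_assoc blinfun_compose_id(1))+
  have RRi: "R o\<^sub>L ?Ri = id_blinfun"
    using H_inv(1) R(3) by (metis blinfun_compose_assoc)
  have adjRi: "op_adj ?Ri = (B o\<^sub>L op_adj B) o\<^sub>L R" using R B by simp
  have LR: "op_adj ?Ri o\<^sub>L R = id_blinfun"
    unfolding adjRi using H_inv(2) R(3) by (metis blinfun_compose_assoc)
  \<comment> \<open>A left and a right inverse of \<open>R\<close> coincide.\<close>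
  have Ri_sa: "op_adj ?Ri = ?Ri"
    using blinfun_compose_assoc[of "op_adj ?Ri" R ?Ri] by (simp only: LR RRi blinfun_compose_id)
  have RiR: "?Ri o\<^sub>L R = id_blinfun" using LR unfolding Ri_sa .
  define U where "U = V o\<^sub>L ?Ri"
  have RiM: "?Ri \<in> M" using R B by simp
  have U: "U \<in> unitaries M"
  proof (rule unitariesI)
    show "U \<in> M" using V RiM by (simp add: U_def)
    have adjU: "op_adj U = ?Ri o\<^sub>L op_adj V"
      unfolding U_def adj_comp[OF V(1) RiM] Ri_sa ..
    have "op_adj U o\<^sub>L U = (?Ri o\<^sub>L R) o\<^sub>L (R o\<^sub>L ?Ri)"
      unfolding adjU unfolding U_def using R(3) by (metis blinfun_compose_assoc)
    then show "op_adj U o\<^sub>L U = id_blinfun" using RRi RiR by simp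
    have RiRi: "?Ri o\<^sub>L ?Ri = B o\<^sub>L op_adj B"
      using RiR by (metis blinfun_compose_assoc blinfun_compose_id(1))
    have "U o\<^sub>L op_adj U = V o\<^sub>L (?Ri o\<^sub>L ?Ri) o\<^sub>L op_adj V"
      unfolding adjU unfolding U_def by (simp only: blinfun_compose_assoc)
    also have "\<dots> = (V o\<^sub>L B) o\<^sub>L (op_adj B o\<^sub>L op_adj V)"
      unfolding RiRi by (simp only: blinfun_compose_assoc)
    finally show "U o\<^sub>L op_adj U = id_blinfun" using B(3) VB'(1) by simp
  qed
  have UR: "U o\<^sub>L R = V"
    unfolding U_def blinfun_compose_assoc[of V] RiR by simp
  have com_ap: "R (Q x) = Q (R x)" for x
    using arg_cong[OF RQ, of "\<lambda>B. blinfun_apply B x"] by simp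
  have sum_ap: "R (R x) + Q (Q x) = x" for x
    using arg_cong[OF Q(3), of "\<lambda>B. blinfun_apply B x"]
      arg_cong[OF R(3), of "\<lambda>B. blinfun_apply B x"] by (simp add: blinfun.bilinear_simps)
  \<comment> \<open>The conditions make the square of \<open>c\<close> equal to \<open>-1\<close>,
    so \<open>\<i>\<close> and \<open>- \<i>\<close> are treated at once; the mixed terms cancel
    because \<open>R\<close> and \<open>Q\<close> commute.\<close>
  have W: "R + op_scale c Q \<in> unitaries M" if c: "c * cnj c = 1" "cnj c = - c" for c
  proof (rule unitariesI)
    have adjW: "op_adj (R + op_scale c Q) = R + op_scale (- c) Q"
      using R Q c by simp
    have cc: "c * c = - 1" using c by (metis add.inverse_inverse mult_minus_right)
    have minus: "(- c) *\<^sub>C x = - (c *\<^sub>C x)" for x :: 'a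
      using scaleC_add_left[of "- c" c x] scaleC_of_real[of 0 x] by (simp add: eq_neg_iff_add_eq_0)
    have ccx: "c *\<^sub>C (c *\<^sub>C x) = - x" for x :: 'a
      using scaleC_of_real[of "-1" x] by (simp add: scaleC_scaleC cc)
    show "R + op_scale c Q \<in> M" using R Q by simp
    show "op_adj (R + op_scale c Q) o\<^sub>L (R + op_scale c Q) = id_blinfun"
      unfolding adjW using R(1) Q(1)
      by (intro blinfun_eqI) (simp add: blinfun.bilinear_simps op_scale_apply M_scaleC minus scaleC_add_right
          ccx com_ap sum_ap)
    show "(R + op_scale c Q) o\<^sub>L op_adj (R + op_scale c Q) = id_blinfun"
      unfolding adjW using R(1) Q(1)
      by (intro blinfun_eqI) (simp add: blinfun.bilinear_simps op_scale_apply M_scaleC minus scaleC_add_right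
          ccx com_ap sum_ap)
  qed
  have "2 *\<^sub>R V = (U o\<^sub>L (R + op_scale \<i> Q)) + (U o\<^sub>L (R + op_scale (- \<i>) Q))"
  proof -
    have m: "op_scale (- \<i>) Q = - op_scale \<i> Q"
    proof (rule blinfun_eqI)
      fix x
      show "op_scale (- \<i>) Q x = (- op_scale \<i> Q) x"
        using scaleC_add_left[of "- \<i>" \<i> "Q x"] scaleC_of_real[of 0 "Q x"]
        by (simp add: op_scale_apply blinfun.bilinear_simps eq_neg_iff_add_eq_0)
    qed
    show ?thesis unfolding m using UR
      by (simp add: blinfun_compose.add_right blinfun_compose.diff_right scaleR_2)
  qed
  then show thesis using that unitaries_comp[OF U W[of \<i>]] unitaries_comp[OF U W[of "- \<i>"]] by simp
qed

text \<open>Kadison--Pedersen: \<open>U + S = U (1 + U\<^sup>* S)\<close> is invertible.\<close>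

lemma unitary_add_contraction:
  assumes U: "U \<in> unitaries M" and S: "S \<in> M" "norm S < 1"
  obtains U1 U2 where "U1 \<in> unitaries M" "U2 \<in> unitaries M" "U + S = U1 + U2"
proof -
  have UM: "U \<in> M" and UU: "op_adj U o\<^sub>L U = id_blinfun" "U o\<^sub>L op_adj U = id_blinfun"
    using U by (auto simp: unitaries_def)
  let ?X = "- (op_adj U o\<^sub>L S)"
  have "norm ?X \<le> 1 * norm S"
    using norm_compose_le[OF norm_unitary_le[OF unitaries_adj[OF U]], of S "norm S"] by simp
  then have n: "norm ?X < 1" using S by simp
  have XM: "?X \<in> M" using UM S by simp
  obtain Z where Z: "Z \<in> M" "(id_blinfun - ?X) o\<^sub>L Z = id_blinfun" "Z o\<^sub>L (id_blinfun - ?X) = id_blinfun"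
    using neumann_inverse[OF XM n] by blast
  let ?V = "(1/2) *\<^sub>R (U + S)" and ?B = "2 *\<^sub>R (Z o\<^sub>L op_adj U)"
  have US: "U o\<^sub>L (id_blinfun - ?X) = U + S"
    by (simp add: blinfun_compose.add_right blinfun_compose_assoc[symmetric] UU)
  have US': "op_adj U o\<^sub>L (U + S) = id_blinfun - ?X"
    by (simp add: blinfun_compose.add_right UU)
  have VM: "?V \<in> M" "?B \<in> M" using UM S Z by auto
  have nV: "norm ?V \<le> 1"
    using norm_triangle_ineq[of U S] norm_unitary_le[OF U] S by simp
  have "?B o\<^sub>L ?V = Z o\<^sub>L (op_adj U o\<^sub>L (U + S))"
    by (simp add: blinfun_compose.scaleR_left blinfun_compose.scaleR_right blinfun_compose_assoc)
  then have BV: "?B o\<^sub>L ?V = id_blinfun" by (simp only: US' Z)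
  have "?V o\<^sub>L ?B = (U + S) o\<^sub>L (Z o\<^sub>L op_adj U)"
    by (simp add: blinfun_compose.scaleR_left blinfun_compose.scaleR_right)
  also have "\<dots> = U o\<^sub>L (((id_blinfun - ?X) o\<^sub>L Z) o\<^sub>L op_adj U)"
    unfolding US[symmetric] by (simp only: blinfun_compose_assoc)
  also have "\<dots> = id_blinfun" by (simp only: Z UU blinfun_compose_id)
  finally have VB: "?V o\<^sub>L ?B = id_blinfun" .
  show thesis
    using invertible_contraction_sum_unitaries[OF VM(1) nV VM(2) BV VB] that by auto
qed

end

text \<open>Lets a constant decrease to its limit when \<open>y\<close> may be infinite: positivity
  of \<open>r\<close> keeps \<open>ennreal r * \<infinity>\<close> infinite, and for finite
  \<open>y\<close> it is the usual epsilon argument.\<close>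

lemma ennreal_le_mult_limit:
  fixes x y :: ennreal
  assumes "r > 0" "\<And>c. c > r \<Longrightarrow> x \<le> ennreal c * y"
  shows "x \<le> ennreal r * y"
proof (cases "y = \<infinity>")
  case True
  then show ?thesis using assms(1) by (simp add: ennreal_mult_top)
next
  case False
  then obtain b where b: "y = ennreal b" "b \<ge> 0" by (cases y) auto
  have fin: "x \<le> ennreal ((r + 1) * b)"
    using assms(2)[of "r + 1"] assms(1) b by (simp add: ennreal_mult)
  then have "x \<noteq> \<infinity>" by (auto simp: top_unique)
  then obtain a where a: "x = ennreal a" "a \<ge> 0" by (cases x) auto
  have "a \<le> r * b"
  proof (rule field_le_epsilon)
    fix e :: real assume e: "e > 0"
    \<comment> \<open>The denominator \<open>b + 1\<close> covers \<open>b = 0\<close> and makes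
      \<open>(c - r) * b\<close> at most \<open>e\<close>.\<close>
    define c where "c = r + e / (b + 1)"
    have c: "c > r" using e b by (simp add: c_def)
    have "a \<le> c * b"
      using assms(2)[OF c] assms(1) a b c by (simp add: ennreal_mult[symmetric])
    also have "\<dots> = r * b + e * (b / (b + 1))" by (simp add: c_def algebra_simps)
    also have "\<dots> \<le> r * b + e * 1"
      using e b by (intro add_left_mono mult_left_mono) auto
    finally show "a \<le> r * b + e" by simp
  qed
  then show ?thesis using a b assms(1) by (simp add: ennreal_mult[symmetric] ennreal_leI)
qed

lemma blinfun_commute_square:
  "A o\<^sub>L H = H o\<^sub>L A \<Longrightarrow> A o\<^sub>L (H o\<^sub>L H) = (H o\<^sub>L H) o\<^sub>L A"
  by (metis blinfun_compose_assoc)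

context vN_algebra
begin

section \<open>The ideal property of the seminorm\<close>

text \<open>Repeated splitting by \<open>unitary_add_contraction\<close> bounds the seminorm of the
  product by \<open>(n + 2) / n\<close> times that of \<open>T\<close>, and \<open>n\<close> is
  arbitrary. Assuming invariance on one side only lets the result be applied to \<open>N\<close>
  composed with \<open>op_adj\<close>.\<close>

lemma seminorm_contraction_left:
  fixes N :: "('a \<Rightarrow>\<^sub>L 'a) \<Rightarrow> ennreal"
  assumes subadd: "\<And>S T. S \<in> M \<Longrightarrow> T \<in> M \<Longrightarrow> N (S + T) \<le> N S + N T"
    and scale: "\<And>r T. r \<ge> 0 \<Longrightarrow> T \<in> M \<Longrightarrow> N (r *\<^sub>R T) = ennreal r * N T"
    and inv: "\<And>U T. U \<in> unitaries M \<Longrightarrow> T \<in> M \<Longrightarrow> N (U o\<^sub>L T) = N T"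
    and S: "S \<in> M" "norm S < 1" and T: "T \<in> M"
  shows "N (S o\<^sub>L T) \<le> N T"
proof -
  \<comment> \<open>\<open>U\<close> stays arbitrary, since each splitting continues with
    \<open>U1\<close> in its place.\<close>
  have step: "N ((U + real n *\<^sub>R S) o\<^sub>L T) \<le> ennreal (real n + 1) * N T" if "U \<in> unitaries M" for U n
    using that
  proof (induction n arbitrary: U)
    case 0
    then show ?case using T by (simp add: inv)
  next
    case (Suc n)
    obtain U1 U2 where U: "U1 \<in> unitaries M" "U2 \<in> unitaries M" "U + S = U1 + U2"
      using unitary_add_contraction[OF Suc.prems S] by blast
    have "U + real (Suc n) *\<^sub>R S = (U + S) + real n *\<^sub>R S" by (simp add: algebra_simps)
    then have "(U + real (Suc n) *\<^sub>R S) o\<^sub>L T = ((U1 + real n *\<^sub>R S) o\<^sub>L T) + (U2 o\<^sub>L T)"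
      unfolding U(3) by (simp add: blinfun_compose.add_left)
    then have "N ((U + real (Suc n) *\<^sub>R S) o\<^sub>L T) \<le> N ((U1 + real n *\<^sub>R S) o\<^sub>L T) + N (U2 o\<^sub>L T)"
      using subadd U S T unitaries_M by (simp add: scaleR_M add_M comp_M)
    also have "\<dots> \<le> ennreal (real n + 1) * N T + ennreal 1 * N T"
      using Suc.IH[OF U(1)] inv[OF U(2) T] by (intro add_mono) auto
    also have "\<dots> = ennreal (real (Suc n) + 1) * N T"
      by (simp only: distrib_right[symmetric] ennreal_plus[symmetric]) simp
    finally show ?case .
  qed
  have bound: "N (S o\<^sub>L T) \<le> ennreal ((real n + 2) / real n) * N T" if n: "n > 0" for n :: nat
  proof -
    \<comment> \<open>Removing the starting unitary \<open>id_blinfun\<close> costs one more copy of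
      \<open>T\<close>, which turns \<open>n + 1\<close> into \<open>n + 2\<close>.\<close>
    have split: "real n *\<^sub>R (S o\<^sub>L T) = ((id_blinfun + real n *\<^sub>R S) o\<^sub>L T) + (-1) *\<^sub>R T"
      by (simp add: blinfun_compose.add_left blinfun_compose.scaleR_left)
    have neg: "N ((-1) *\<^sub>R T) = N T"
    proof -
      have "- id_blinfun \<in> unitaries M"
      proof (rule unitariesI)
        have "op_adj (- id_blinfun :: 'a \<Rightarrow>\<^sub>L 'a) = - id_blinfun"
          using adj_scaleR[OF id_M, of "-1"] by simp
        then show "op_adj (- id_blinfun) o\<^sub>L - id_blinfun = (id_blinfun :: 'a \<Rightarrow>\<^sub>L 'a)"
          "- id_blinfun o\<^sub>L op_adj (- id_blinfun) = (id_blinfun :: 'a \<Rightarrow>\<^sub>L 'a)"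
          by (simp_all add: blinfun_compose.minus_left blinfun_compose.minus_right)
      qed simp
      from inv[OF this T] show ?thesis by (simp add: blinfun_compose.minus_left)
    qed
    have "ennreal (real n) * N (S o\<^sub>L T) = N (real n *\<^sub>R (S o\<^sub>L T))"
      using S T by (simp add: scale)
    also have "\<dots> \<le> N ((id_blinfun + real n *\<^sub>R S) o\<^sub>L T) + N ((-1) *\<^sub>R T)"
      unfolding split using S T by (intro subadd) auto
    also have "\<dots> \<le> ennreal (real n + 1) * N T + ennreal 1 * N T"
      unfolding neg using step[OF unitaries_id, of n] by (intro add_mono) auto
    also have "\<dots> = ennreal (real n + 2) * N T"
      by (simp only: distrib_right[symmetric] ennreal_plus[symmetric]) (simp add: add_ac)
    finally have "ennreal (1 / real n) * (ennreal (real n) * N (S o\<^sub>L T))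
        \<le> ennreal (1 / real n) * (ennreal (real n + 2) * N T)"
      by (intro mult_left_mono) auto
    moreover have "ennreal (1 / real n) * ennreal (real n) = 1"
      using n by (simp add: ennreal_mult[symmetric])
    moreover have "ennreal (1 / real n) * ennreal (real n + 2) = ennreal ((real n + 2) / real n)"
      by (simp add: ennreal_mult[symmetric] del: ennreal_plus)
    ultimately show ?thesis by (simp only: mult.assoc[symmetric] mult_1)
  qed
  have "N (S o\<^sub>L T) \<le> ennreal 1 * N T"
  proof (rule ennreal_le_mult_limit)
    fix c :: real assume c: "c > 1"
    obtain n :: nat where n: "2 / (c - 1) < real n" using reals_Archimedean2 by blast
    moreover have "2 / (c - 1) > 0" using c by simp
    ultimately have n0: "n > 0" by (metis of_nat_0_less_iff order_less_trans)
    have "(real n + 2) / real n \<le> c" using n n0 c by (simp add: field_simps)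
    then show "N (S o\<^sub>L T) \<le> ennreal c * N T"
      using bound[OF n0] by (meson ennreal_leI mult_right_mono order_trans zero_le)
  qed simp
  then show ?thesis by simp
qed

text \<open>Dividing \<open>S\<close> by \<open>c > norm S\<close> gives a strict contraction, and
  \<open>c\<close> then decreases to \<open>norm S\<close>. The zero operator is separate because
  \<open>ennreal_le_mult_limit\<close> asks for a positive constant.\<close>

lemma seminorm_mult_left:
  fixes N :: "('a \<Rightarrow>\<^sub>L 'a) \<Rightarrow> ennreal"
  assumes subadd: "\<And>S T. S \<in> M \<Longrightarrow> T \<in> M \<Longrightarrow> N (S + T) \<le> N S + N T"
    and scale: "\<And>r T. r \<ge> 0 \<Longrightarrow> T \<in> M \<Longrightarrow> N (r *\<^sub>R T) = ennreal r * N T"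
    and inv: "\<And>U T. U \<in> unitaries M \<Longrightarrow> T \<in> M \<Longrightarrow> N (U o\<^sub>L T) = N T"
    and S: "S \<in> M" and T: "T \<in> M"
  shows "N (S o\<^sub>L T) \<le> ennreal (norm S) * N T"
proof (cases "S = 0")
  case True
  have "N 0 = 0" using scale[of 0 0] by simp
  then show ?thesis using True by simp
next
  case False
  show ?thesis
  proof (rule ennreal_le_mult_limit)
    show "norm S > 0" using False by simp
    fix c assume c: "c > norm S"
    then have c0: "c > 0" by (metis norm_ge_zero order_le_less_trans)
    have "N (((1 / c) *\<^sub>R S) o\<^sub>L T) \<le> N T"
      by (rule seminorm_contraction_left[OF subadd scale inv]) (use S T c c0 in auto)
    then have "ennreal c * N (((1 / c) *\<^sub>R S) o\<^sub>L T) \<le> ennreal c * N T"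
      by (intro mult_left_mono) auto
    moreover have "ennreal c * N (((1 / c) *\<^sub>R S) o\<^sub>L T) = N (c *\<^sub>R (((1 / c) *\<^sub>R S) o\<^sub>L T))"
      using c0 S T by (simp add: scale)
    moreover have "c *\<^sub>R (((1 / c) *\<^sub>R S) o\<^sub>L T) = S o\<^sub>L T"
      using c0 by (simp add: blinfun_compose.scaleR_left)
    ultimately show "N (S o\<^sub>L T) \<le> ennreal c * N T" by simp
  qed
qed

text \<open>Adjoints exchange the two sides and preserve norms and unitaries, so the left version
  applies to \<open>N\<close> composed with \<open>op_adj\<close>.\<close>

lemma seminorm_mult_right:
  fixes N :: "('a \<Rightarrow>\<^sub>L 'a) \<Rightarrow> ennreal"
  assumes subadd: "\<And>S T. S \<in> M \<Longrightarrow> T \<in> M \<Longrightarrow> N (S + T) \<le> N S + N T"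
    and scale: "\<And>r T. r \<ge> 0 \<Longrightarrow> T \<in> M \<Longrightarrow> N (r *\<^sub>R T) = ennreal r * N T"
    and inv: "\<And>U T. U \<in> unitaries M \<Longrightarrow> T \<in> M \<Longrightarrow> N (T o\<^sub>L U) = N T"
    and S: "S \<in> M" and T: "T \<in> M"
  shows "N (T o\<^sub>L S) \<le> ennreal (norm S) * N T"
proof -
  have "N (op_adj (op_adj S o\<^sub>L op_adj T)) \<le> ennreal (norm (op_adj S)) * N (op_adj (op_adj T))"
    by (rule seminorm_mult_left[where N = "\<lambda>T. N (op_adj T)"])
       (use S T subadd scale inv unitaries_adj unitaries_M in auto)
  then show ?thesis using S T by simp
qed

section \<open>Spectral projections and comparison\<close>

lemma projections_M: "P \<in> projections M \<Longrightarrow> P \<in> M"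
  by (simp add: projections_def)

lemma projection_idem: "P \<in> projections M \<Longrightarrow> P (P x) = P x"
  unfolding projections_def using blinfun_apply_blinfun_compose[of P P x] by simp

lemma projection_inner: "P \<in> projections M \<Longrightarrow> inner (P x) y = inner x (P y)"
  using adj_inner[of P x y] by (simp add: projections_def)

lemma projection_norm: "P \<in> projections M \<Longrightarrow> (norm (P x))\<^sup>2 = inner (P x) x"
  by (simp add: power2_norm_eq_inner projection_inner projection_idem)

lemma projection_range: "P \<in> projections M \<Longrightarrow> x \<in> range P \<longleftrightarrow> P x = x"
  using projection_idem by (metis rangeE rangeI)

lemma projection_diff:
  assumes "P \<in> projections M" "Q \<in> projections M" "P o\<^sub>L Q = Q" "Q o\<^sub>L P = Q"
  shows "P - Q \<in> projections M"
  using assms by (simp add: projections_def blinfun_compose.diff_left blinfun_compose.diff_right)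

text \<open>With \<open>H = T\<^sup>* T - d\<^sup>2\<close>, the kernel of \<open>\<bar>H\<bar> - H\<close> is a spectral subspace of \<open>T\<^sup>* T\<close> on
  which \<open>T\<close> is bounded below by \<open>d\<close>.\<close>

lemma spectral_projection:
  assumes T: "T \<in> M" and d: "0 < d" "d < norm T" and P: "P \<in> projections M" "T o\<^sub>L P = T"
  obtains E where "E \<in> projections M" "E \<noteq> 0" "\<And>x. d * norm (E x) \<le> norm (T (E x))" "P o\<^sub>L E = E"
proof -
  let ?H = "(op_adj T o\<^sub>L T) - d\<^sup>2 *\<^sub>R id_blinfun"
  have HM: "?H \<in> M" "op_adj ?H = ?H" using T by auto
  have PM: "P \<in> M" "op_adj P = P" using P by (auto simp: projections_def)
  have Hx: "?H x = op_adj T (T x) - d\<^sup>2 *\<^sub>R x" for x by (simp add: blinfun.bilinear_simps)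
  have inner_H: "inner (?H x) x = (norm (T x))\<^sup>2 - d\<^sup>2 * (norm x)\<^sup>2" for x
    unfolding Hx norm_square_adj[OF T] by (simp add: inner_diff_left power2_norm_eq_inner)
  obtain R where R: "R \<in> M" "op_adj R = R" "R o\<^sub>L R = op_adj ?H o\<^sub>L ?H" "\<And>x. inner (R x) x \<ge> 0"
    and Rcom: "\<And>A. A o\<^sub>L (op_adj ?H o\<^sub>L ?H) = (op_adj ?H o\<^sub>L ?H) o\<^sub>L A \<Longrightarrow> A o\<^sub>L R = R o\<^sub>L A"
    using abs_exists[OF HM(1)] by blast
  have com_of: "A o\<^sub>L R = R o\<^sub>L A" if "A o\<^sub>L ?H = ?H o\<^sub>L A" for A
  proof (rule Rcom)
    show "A o\<^sub>L (op_adj ?H o\<^sub>L ?H) = (op_adj ?H o\<^sub>L ?H) o\<^sub>L A"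
      unfolding HM(2) using that by (rule blinfun_commute_square)
  qed
  have HR: "?H o\<^sub>L R = R o\<^sub>L ?H" by (rule com_of) simp
  have RR: "R (R x) = ?H (?H x)" for x
    using arg_cong[OF R(3), of "\<lambda>B. blinfun_apply B x"] unfolding HM(2) by simp
  have HR_ap: "?H (R x) = R (?H x)" for x
    using arg_cong[OF HR, of "\<lambda>B. blinfun_apply B x"] by simp
  let ?K = "{x. R x = ?H x}"
  have clK: "closed ?K" by (intro closed_Collect_eq continuous_intros)
  have subK: "subspace ?K" unfolding subspace_def by (auto simp: blinfun.add_right blinfun.scaleR_right)
  have scK: "c *\<^sub>C x \<in> ?K" if "x \<in> ?K" for c x using that R(1) HM(1) by (simp only: mem_Collect_eq M_scaleC)
  have comK: "A x \<in> ?K" if "A \<in> commutant M" "x \<in> ?K" for A x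
    using that(2) by (simp only: mem_Collect_eq commutant_apply[OF that(1) R(1), symmetric]
        commutant_apply[OF that(1) HM(1), symmetric])
  obtain E where E: "E \<in> projections M" "range E = ?K"
    using projection_onto[OF clK subK scK comK] by blast
  have EK: "R (E x) = ?H (E x)" for x using E(2) by blast
  have lower: "d * norm (E x) \<le> norm (T (E x))" for x
  proof -
    \<comment> \<open>On the range of \<open>E\<close> the operator \<open>?H\<close> coincides with
      the positive \<open>R\<close>.\<close>
    have "inner (?H (E x)) (E x) \<ge> 0" using R(4)[of "E x"] by (simp only: EK)
    then have "(d * norm (E x))\<^sup>2 \<le> (norm (T (E x)))\<^sup>2" by (simp add: inner_H power_mult_distrib)
    then show ?thesis by (rule power2_le_imp_le) simp
  qed
  have "E \<noteq> 0"
  proof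
    assume E0: "E = 0"
    have neg: "R x = - ?H x" for x
    proof -
      \<comment> \<open>\<open>R\<close> and \<open>?H\<close> commute and have the same square, so
        \<open>R - ?H\<close> annihilates the range of \<open>R + ?H\<close>. If \<open>?K\<close>
        were zero, \<open>?H\<close> would equal \<open>- R\<close>, forcing
        \<open>norm T \<le> d\<close>.\<close>
      have "R (R x + ?H x) = ?H (R x + ?H x)"
        unfolding blinfun.add_right RR HR_ap by (simp only: add.commute)
      then have "R x + ?H x \<in> range E" unfolding E(2) by blast
      then have "R x + ?H x = 0" using E0 by auto
      then show ?thesis by (simp only: eq_neg_iff_add_eq_0)
    qed
    have "norm T \<le> d"
    proof (rule norm_blinfun_bound)
      fix x
      have "inner (?H x) x \<le> 0" using R(4)[of x] unfolding neg by simp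
      then have "(norm (T x))\<^sup>2 \<le> (d * norm x)\<^sup>2" by (simp add: inner_H power_mult_distrib)
      then show "norm (T x) \<le> d * norm x" by (rule power2_le_imp_le) (use d in simp)
    qed (use d in simp)
    then show False using d by simp
  qed
  have P_ap: "T (P x) = T x" for x
    using arg_cong[OF P(2), of "\<lambda>B. blinfun_apply B x"] by simp
  have PT: "P o\<^sub>L op_adj T = op_adj T"
    using arg_cong[OF P(2), of op_adj] T PM by simp
  \<comment> \<open>The support condition \<open>T o\<^sub>L P = T\<close> and its adjoint make
    \<open>P\<close> commute with \<open>?H\<close>, hence with \<open>R\<close>.\<close>
  have "P o\<^sub>L ?H = ?H o\<^sub>L P"
    using PT P(2) by (simp add: blinfun_compose.diff_left blinfun_compose.diff_right
        blinfun_compose.scaleR_left blinfun_compose.scaleR_right blinfun_compose_assoc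
        blinfun_compose_assoc[symmetric, of P "op_adj T" T])
  from com_of[OF this] this have PR_ap: "P (R x) = R (P x)" and PH_ap: "P (?H x) = ?H (P x)" for x
    by (metis blinfun_apply_blinfun_compose)+
  have "P (E x) = E x" for x
  proof -
    \<comment> \<open>\<open>y\<close> is killed by \<open>T\<close> but still satisfies
      \<open>R y = ?H y\<close>, which bounds \<open>T\<close> below by \<open>d\<close> there; so
      it vanishes and \<open>E\<close> lies below \<open>P\<close>.\<close>
    define y where "y = E x - P (E x)"
    have Ty: "T y = 0" by (simp add: y_def blinfun.diff_right P_ap)
    have "R y = ?H y"
      unfolding y_def blinfun.diff_right[of R] blinfun.diff_right[of ?H] PR_ap[symmetric] PH_ap[symmetric] EK ..
    then have "inner (?H y) y \<ge> 0" using R(4)[of y] by simp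
    then have "d\<^sup>2 * (norm y)\<^sup>2 \<le> 0" by (simp add: inner_H Ty)
    then have "y = 0" using d by (simp add: mult_le_0_iff)
    then show ?thesis by (simp add: y_def)
  qed
  then have "P o\<^sub>L E = E" by (auto intro: blinfun_eqI)
  then show thesis using that E \<open>E \<noteq> 0\<close> lower by blast
qed

end

section \<open>Orthogonal series and separability\<close>

text \<open>By Pythagoras, the squared norm of a finite block equals its sum of squares, so the
  Cauchy criterion transfers and the norm identity passes to the limit.\<close>

lemma orthogonal_series_summable:
  fixes w :: "nat \<Rightarrow> 'a::{real_inner,banach}"
  assumes orth: "\<And>m n. m \<noteq> n \<Longrightarrow> inner (w m) (w n) = 0"
    and sq: "summable (\<lambda>n. (norm (w n))\<^sup>2)"
  shows "summable w" "(norm (suminf w))\<^sup>2 = (\<Sum>n. (norm (w n))\<^sup>2)"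
proof -
  have pyth: "(norm (sum w A))\<^sup>2 = (\<Sum>n\<in>A. (norm (w n))\<^sup>2)" if "finite A" for A
    by (rule norm_sum_Pythagorean[OF that]) (simp add: pairwise_def orthogonal_def orth)
  show sm: "summable w"
    unfolding summable_Cauchy
  proof (intro allI impI)
    fix e :: real assume e: "e > 0"
    then have "e\<^sup>2 > 0" by simp
    then obtain N where N: "\<And>m n. m \<ge> N \<Longrightarrow> norm (\<Sum>k=m..<n. (norm (w k))\<^sup>2) < e\<^sup>2"
      using sq unfolding summable_Cauchy by blast
    have "norm (sum w {m..<n}) < e" if "m \<ge> N" for m n
    proof (rule power2_less_imp_less)
      show "(norm (sum w {m..<n}))\<^sup>2 < e\<^sup>2"
        using N[OF that, of n] by (simp add: pyth sum_nonneg)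
    qed (use e in simp)
    then show "\<exists>N. \<forall>m\<ge>N. \<forall>n. norm (sum w {m..<n}) < e" by blast
  qed
  show "(norm (suminf w))\<^sup>2 = (\<Sum>n. (norm (w n))\<^sup>2)"
  proof (rule LIMSEQ_unique)
    show "(\<lambda>n. (norm (sum w {..<n}))\<^sup>2) \<longlonglongrightarrow> (norm (suminf w))\<^sup>2"
      by (intro tendsto_power tendsto_norm summable_LIMSEQ sm)
    show "(\<lambda>n. (norm (sum w {..<n}))\<^sup>2) \<longlonglongrightarrow> (\<Sum>n. (norm (w n))\<^sup>2)"
      by (simp add: pyth summable_LIMSEQ sq)
  qed
qed

text \<open>Orthonormal vectors have distance \<open>\<surd>2\<close>, so distinct ones have distinct approximants in a
  countable dense set.\<close>

lemma countable_orthonormal: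
  fixes u :: "'i \<Rightarrow> 'a::real_inner"
  assumes sep: "separable_space (euclidean :: 'a topology)"
    and unit: "\<And>i. i \<in> I \<Longrightarrow> norm (u i) = 1"
    and orth: "\<And>i j. i \<in> I \<Longrightarrow> j \<in> I \<Longrightarrow> i \<noteq> j \<Longrightarrow> inner (u i) (u j) = 0"
  shows "countable I"
proof -
  obtain D :: "'a set" where D: "countable D" "closure D = UNIV"
    using sep unfolding separable_space_def by auto
  have "\<exists>d\<in>D. dist d (u i) < 1/2" for i
    using D(2) closure_approachable[of "u i" D] by (metis UNIV_I half_gt_zero zero_less_one)
  then obtain d where d: "\<And>i. d i \<in> D" "\<And>i. dist (d i) (u i) < 1/2" by metis
  have "inj_on d I"
  proof (rule inj_onI, rule ccontr)
    fix i j assume ij: "i \<in> I" "j \<in> I" "d i = d j" "i \<noteq> j"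
    have "dist (u i) (u j) < 1"
      using dist_triangle_half_r[of "d i" "u i" 1 "u j"] d(2)[of i] d(2)[of j] ij(3) by simp
    then have "(norm (u i - u j))\<^sup>2 < 1" by (simp add: dist_norm abs_square_less_1)
    moreover have "(norm (u i - u j))\<^sup>2 = 2"
      using unit[OF ij(1)] unit[OF ij(2)] orth[OF ij(1,2,4)] unfolding norm_eq_1
      by (simp add: power2_norm_eq_inner inner_diff inner_commute)
    ultimately show False by simp
  qed
  moreover have "d ` I \<subseteq> D" using d(1) by blast
  ultimately show ?thesis using D(1) by (metis countable_image_inj_on countable_subset)
qed

section \<open>Orthogonal copies inside an infinite projection\<close>

primrec blinfun_power :: "('a::real_normed_vector \<Rightarrow>\<^sub>L 'a) \<Rightarrow> nat \<Rightarrow> ('a \<Rightarrow>\<^sub>L 'a)" where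
  "blinfun_power V 0 = id_blinfun"
| "blinfun_power V (Suc n) = V o\<^sub>L blinfun_power V n"

lemma blinfun_power_add: "blinfun_power V (m + n) x = blinfun_power V m (blinfun_power V n x)"
  by (induction m) auto

context vN_algebra
begin

lemma blinfun_power_M: "V \<in> M \<Longrightarrow> blinfun_power V n \<in> M"
  by (induction n) auto

text \<open>\<open>V\<close> maps the range of \<open>E\<close> isometrically onto the strictly
  smaller range of \<open>Q\<close>. As in the Wold decomposition, the powers of \<open>V\<close>,
  taken as \<open>J\<close>, move the range of \<open>G = E - Q\<close> to mutually orthogonal
  subspaces.\<close>

lemma infinite_projection_copies:
  assumes E: "E \<in> projections M" "\<not> finite_projection M E"
  obtains G and J :: "nat \<Rightarrow> 'a \<Rightarrow>\<^sub>L 'a" where "G \<in> projections M" "G \<noteq> 0"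
    "\<And>n. J n \<in> M" "\<And>n x. E (J n (G x)) = J n (G x)" "\<And>n x. norm (J n (G x)) = norm (G x)"
    "\<And>m n x y. m \<noteq> n \<Longrightarrow> inner (J m (G x)) (J n (G y)) = 0"
proof -
  obtain Q where Q: "Q \<in> projections M" "mvn_equiv M E Q" "proj_le Q E" "Q \<noteq> E"
    using E unfolding finite_projection_def by blast
  obtain V where V: "V \<in> M" "op_adj V o\<^sub>L V = E" "V o\<^sub>L op_adj V = Q"
    using Q(2) unfolding mvn_equiv_def by blast
  have EQ_ap: "E (Q x) = Q x" for x
    using Q(3) projection_range[OF E(1), of "Q x"] unfolding proj_le_def by blast
  then have EQ: "E o\<^sub>L Q = Q" by (auto intro: blinfun_eqI)
  have QE: "Q o\<^sub>L E = Q"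
    using arg_cong[OF EQ, of op_adj] E(1) Q(1) by (auto simp: projections_def)
  have VV: "op_adj V (V x) = E x" for x
    using arg_cong[OF V(2), of "\<lambda>B. blinfun_apply B x"] by simp
  have VV': "V (op_adj V x) = Q x" for x
    using arg_cong[OF V(3), of "\<lambda>B. blinfun_apply B x"] by simp
  have VE: "V (E x) = V x" for x
  proof -
    \<comment> \<open>\<open>V\<close> vanishes on the kernel of its initial projection
      \<open>E\<close>.\<close>
    have "(norm (V (x - E x)))\<^sup>2 = inner (E (x - E x)) (x - E x)"
      using V(1) by (simp add: norm_square_adj VV)
    also have "\<dots> = 0" by (simp add: blinfun.diff_right projection_idem[OF E(1)])
    finally show ?thesis by (simp add: blinfun.diff_right)
  qed
  have QV: "Q (V x) = V x" for x
    using VV'[of "V x"] by (simp add: VV VE)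
  have EV: "E (V x) = V x" for x
    using EQ_ap[of "V x"] by (simp add: QV)
  define G where "G = E - Q"
  have G: "G \<in> projections M" unfolding G_def
    by (rule projection_diff[OF E(1) Q(1) EQ QE])
  have G0: "G \<noteq> 0" using Q(4) by (simp add: G_def)
  have GV: "G (V x) = 0" for x by (simp add: G_def blinfun.diff_left EV QV)
  have EG: "E (G x) = G x" for x
    by (simp add: G_def blinfun.diff_left blinfun.diff_right EQ_ap projection_idem[OF E(1)])
  let ?J = "blinfun_power V"
  have EJ: "E (?J n (G x)) = ?J n (G x)" for n x
    by (cases n) (simp_all add: EG EV)
  have iso: "inner (V x) (V y) = inner (E x) y" for x y
    using adj_inner'[OF V(1), of "V x" y] by (simp add: VV)
  have J_iso: "inner (?J n x) (?J n y) = inner x y" if "E x = x" for n x y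
    using that
  proof (induction n)
    case (Suc n)
    have "E (?J n x) = ?J n x" using that by (cases n) (simp_all add: EV)
    then show ?case using Suc by (simp add: iso)
  qed simp
  have less: "inner (?J m (G x)) (?J n (G y)) = 0" if "m < n" for m n x y
  proof -
    obtain k where k: "n = m + Suc k" using \<open>m < n\<close> less_iff_Suc_add by auto
    \<comment> \<open>Cancelling \<open>m\<close> isometric factors leaves at least one
      \<open>V\<close> on the right, whose range is killed by \<open>G\<close>.\<close>
    have "inner (?J m (G x)) (?J n (G y)) = inner (G x) (V (?J k (G y)))"
      unfolding k blinfun_power_add by (simp add: J_iso EG)
    also have "\<dots> = 0" by (simp add: projection_inner[OF G] GV)
    finally show ?thesis .
  qed
  show thesis
  proof (rule that[of G ?J, OF G G0])
    show "?J n \<in> M" for n using V(1) by (rule blinfun_power_M)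
    show "E (?J n (G x)) = ?J n (G x)" for n x by (rule EJ)
    show "norm (?J n (G x)) = norm (G x)" for n x
      by (simp add: norm_eq_sqrt_inner J_iso EG)
    show "inner (?J m (G x)) (?J n (G y)) = 0" if "m \<noteq> n" for m n x y
      using that less[of m n x y] less[of n m y x] by (auto simp: inner_commute neq_iff)
  qed
qed

section \<open>Maximal orthogonal families of projections\<close>

lemma projection_orthogonal_sym:
  assumes "P \<in> projections M" "Q \<in> projections M" "P o\<^sub>L Q = 0"
  shows "Q o\<^sub>L P = 0"
proof (rule blinfun_eqI)
  fix x
  have PQ: "P (Q y) = 0" for y
    using arg_cong[OF assms(3), of "\<lambda>B. blinfun_apply B y"] by simp
  have "inner y (Q (P x)) = 0" for y
    by (simp add: projection_inner[OF assms(2), symmetric] projection_inner[OF assms(1), symmetric] PQ)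
  from this[of "Q (P x)"] show "(Q o\<^sub>L P) x = (0 :: 'a \<Rightarrow>\<^sub>L 'a) x" by simp
qed

text \<open>Zorn's lemma gives a maximal family. If its members had a nonzero common kernel, the
  projection onto that kernel would lie in \<open>M\<close> and dominate a further good
  projection.\<close>

lemma maximal_orthogonal_family:
  assumes good: "\<And>P. P \<in> projections M \<Longrightarrow> P \<noteq> 0 \<Longrightarrow>
      \<exists>E\<in>projections M. E \<noteq> 0 \<and> good E \<and> P o\<^sub>L E = E"
  obtains F where "F \<subseteq> projections M" "0 \<notin> F" "\<And>g. g \<in> F \<Longrightarrow> good g"
    "pairwise (\<lambda>g h. g o\<^sub>L h = 0) F" "\<And>x. (\<And>g. g \<in> F \<Longrightarrow> g x = 0) \<Longrightarrow> x = 0"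
proof -
  define \<A> where "\<A> = {F. F \<subseteq> {g \<in> projections M. g \<noteq> 0 \<and> good g} \<and> pairwise (\<lambda>g h. g o\<^sub>L h = 0) F}"
  have "\<exists>F\<in>\<A>. \<forall>X\<in>\<A>. F \<subseteq> X \<longrightarrow> X = F"
  proof (rule subset_Zorn_nonempty)
    show "\<A> \<noteq> {}" unfolding \<A>_def by (auto intro!: exI[of _ "{}"])
    fix \<C> assume "\<C> \<noteq> {}" and C: "subset.chain \<A> \<C>"
    then have sub: "\<C> \<subseteq> \<A>" and ch: "chain\<^sub>\<subseteq> \<C>"
      by (auto simp: subset_chain_def chain_subset_def)
    have "pairwise (\<lambda>g h. g o\<^sub>L h = 0) (\<Union>\<C>)"
      by (rule pairwise_chain_Union[OF _ ch]) (use sub in \<open>auto simp: \<A>_def\<close>)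
    then show "\<Union>\<C> \<in> \<A>" using sub unfolding \<A>_def by blast
  qed
  then obtain F where F: "F \<in> \<A>" and max: "\<And>X. X \<in> \<A> \<Longrightarrow> F \<subseteq> X \<Longrightarrow> X = F" by blast
  have Fp: "g \<in> projections M" "g \<noteq> 0" "good g" if "g \<in> F" for g
    using F that by (auto simp: \<A>_def)
  have pw: "pairwise (\<lambda>g h. g o\<^sub>L h = 0) F" using F by (simp add: \<A>_def)
  let ?K = "{x. \<forall>g\<in>F. blinfun_apply g x = 0}"
  have K: "closed ?K" "subspace ?K" "\<And>c x. x \<in> ?K \<Longrightarrow> c *\<^sub>C x \<in> ?K"
    "\<And>A x. A \<in> commutant M \<Longrightarrow> x \<in> ?K \<Longrightarrow> A x \<in> ?K"
  proof -
    have "?K = (\<Inter>g\<in>F. {x. blinfun_apply g x = 0})" by auto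
    then show "closed ?K" by (auto intro!: closed_INT closed_Collect_eq continuous_intros)
    show "subspace ?K" by (auto simp: subspace_def blinfun.bilinear_simps)
    have sc0: "c *\<^sub>C (0::'a) = 0" for c using norm_scaleC[of c "0::'a"] by simp
    show "c *\<^sub>C x \<in> ?K" if "x \<in> ?K" for c x
      using that Fp(1)[THEN projections_M] by (simp add: M_scaleC sc0)
    show "A x \<in> ?K" if "A \<in> commutant M" "x \<in> ?K" for A x
      using that Fp(1)[THEN projections_M] by (simp add: commutant_apply[OF that(1), symmetric])
  qed
  obtain P where P: "P \<in> projections M" "range P = ?K"
    using projection_onto[OF K] by blast
  have "P = 0"
  proof (rule ccontr)
    assume "P \<noteq> 0"
    then obtain E where E: "E \<in> projections M" "E \<noteq> 0" "good E" "P o\<^sub>L E = E"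
      using good P(1) by blast
    have PE: "P (E x) = E x" for x
      using arg_cong[OF E(4), of "\<lambda>B. blinfun_apply B x"] by simp
    have gE: "g o\<^sub>L E = 0" if "g \<in> F" for g
    proof (rule blinfun_eqI)
      fix x
      have "E x \<in> ?K" using P(2) PE by (metis rangeI)
      then show "(g o\<^sub>L E) x = (0 :: 'a \<Rightarrow>\<^sub>L 'a) x" using that by simp
    qed
    have Eg: "E o\<^sub>L g = 0" if "g \<in> F" for g
      by (rule projection_orthogonal_sym[OF Fp(1) E(1) gE]) (use that in auto)
    have "insert E F \<in> \<A>"
      using F E gE Eg by (auto simp: \<A>_def pairwise_insert)
    \<comment> \<open>Being orthogonal to every member of \<open>F\<close>, \<open>E\<close> would
      be orthogonal to itself.\<close>
    then have "E \<in> F" using max[of "insert E F"] by blast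
    from gE[OF this] have "E = 0" using E(1) by (simp add: projections_def)
    then show False using E(2) by simp
  qed
  have total: "x = 0" if "\<forall>g\<in>F. blinfun_apply g x = 0" for x
  proof -
    have "x \<in> range P" unfolding P(2) using that by blast
    then show ?thesis using \<open>P = 0\<close> by auto
  qed
  show thesis
  proof (rule that[of F])
    show "F \<subseteq> projections M" "0 \<notin> F" using Fp by auto
    show "good g" if "g \<in> F" for g using Fp(3)[OF that] .
    show "pairwise (\<lambda>g h. g o\<^sub>L h = 0) F" by (rule pw)
    show "x = 0" if "\<And>g. g \<in> F \<Longrightarrow> g x = 0" for x using total that by blast
  qed
qed

text \<open>Unit vectors chosen from the ranges form an orthonormal family, so separability makes
  the family of projections countable. The sequence is padded with zeros, which is why
  \<open>good 0\<close> is assumed.\<close>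

lemma maximal_orthogonal_sequence:
  assumes sep: "separable_space (euclidean :: 'a topology)"
    and good: "\<And>P. P \<in> projections M \<Longrightarrow> P \<noteq> 0 \<Longrightarrow>
      \<exists>E\<in>projections M. E \<noteq> 0 \<and> good E \<and> P o\<^sub>L E = E"
    and good0: "good 0"
  obtains g :: "nat \<Rightarrow> 'a \<Rightarrow>\<^sub>L 'a" where "\<And>n. g n \<in> projections M" "\<And>n. good (g n)"
    "\<And>m n x. m \<noteq> n \<Longrightarrow> g m (g n x) = 0" "\<And>x. (\<And>n. g n x = 0) \<Longrightarrow> x = 0"
proof -
  obtain F where F: "F \<subseteq> projections M" "0 \<notin> F" "\<And>g. g \<in> F \<Longrightarrow> good g"
    "pairwise (\<lambda>g h. g o\<^sub>L h = 0) F" "\<And>x. (\<And>g. g \<in> F \<Longrightarrow> g x = 0) \<Longrightarrow> x = 0"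
    using maximal_orthogonal_family[OF good] by blast
  have orthF: "g (h x) = 0" if "g \<in> F" "h \<in> F" "g \<noteq> h" for g h x
  proof -
    have "g o\<^sub>L h = 0" using F(4) that by (simp add: pairwise_def)
    from arg_cong[OF this, of "\<lambda>B. blinfun_apply B x"] show ?thesis by simp
  qed
  have "\<exists>u. g u = u \<and> norm u = 1" if "g \<in> F" for g
  proof -
    have "g \<noteq> 0" using that F(2) by auto
    then obtain x where x: "g x \<noteq> 0" using blinfun_eqI[of g 0] by auto
    have "g (g x) = g x" using projection_idem F(1) that by blast
    then show ?thesis
      using x by (intro exI[of _ "(1 / norm (g x)) *\<^sub>R g x"]) (simp add: blinfun.scaleR_right)
  qed
  then obtain u where u: "\<And>g. g \<in> F \<Longrightarrow> blinfun_apply g (u g) = u g" "\<And>g. g \<in> F \<Longrightarrow> norm (u g) = 1"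
    by metis
  have "inner (u g) (u h) = 0" if gh: "g \<in> F" "h \<in> F" "g \<noteq> h" for g h
  proof -
    have "g \<in> projections M" using F(1) gh(1) by blast
    then have "inner (g (u g)) (h (u h)) = 0" by (simp only: projection_inner orthF[OF gh] inner_zero_right)
    then show ?thesis by (simp only: u(1) gh)
  qed
  then have cF: "countable F" using countable_orthonormal[OF sep, of F u] u(2) by blast
  then obtain f :: "('a \<Rightarrow>\<^sub>L 'a) \<Rightarrow> nat" where f: "inj_on f F" by (rule countableE)
  \<comment> \<open>\<open>f\<close> need not be onto; indices it misses receive the zero
    projection.\<close>
  define g where "g n = (if n \<in> f ` F then inv_into F f n else 0)" for n
  have gF: "g n \<in> F \<and> f (g n) = n \<or> g n = 0" for n
    by (auto simp: g_def inv_into_into f_inv_into_f)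
  have p0: "0 \<in> projections M"
    by (auto simp: projections_def intro!: adjI)
  show thesis
  proof (rule that[of g])
    show "g n \<in> projections M" for n using gF[of n] F(1) p0 by auto
    show "good (g n)" for n using gF[of n] F(3) good0 by auto
    show "g m (g n x) = 0" if "m \<noteq> n" for m n x
    proof (cases "g m = 0 \<or> g n = 0")
      case False
      then have "g m \<in> F" "g n \<in> F" "g m \<noteq> g n" using gF[of m] gF[of n] that by auto
      then show ?thesis by (rule orthF)
    qed auto
    show "x = 0" if "\<And>n. g n x = 0" for x
    proof (rule F(5))
      fix h assume h: "h \<in> F"
      then have "g (f h) = h" using f by (simp add: g_def)
      then show "h x = 0" using that[of "f h"] by simp
    qed
  qed
qed

text \<open>Parseval's identity: Bessel's inequality makes the series converge, and every
  \<open>g m\<close> annihilates the difference between \<open>x\<close> and the sum, which is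
  therefore zero by totality.\<close>

lemma projection_sequence_complete:
  assumes g: "\<And>n. g n \<in> projections M"
    and orth: "\<And>m n x. m \<noteq> n \<Longrightarrow> g m (g n x) = 0"
    and tot: "\<And>x. (\<And>n. g n x = 0) \<Longrightarrow> x = 0"
  shows "summable (\<lambda>n. (norm (g n x))\<^sup>2)" "(\<Sum>n. (norm (g n x))\<^sup>2) = (norm x)\<^sup>2"
proof -
  have orth': "inner (g m x) (g n x) = 0" if "m \<noteq> n" for m n
    using that orth by (simp add: projection_inner[OF g])
  have bessel: "(\<Sum>n<N. (norm (g n x))\<^sup>2) \<le> (norm x)\<^sup>2" for N
  proof -
    let ?y = "\<Sum>n<N. g n x"
    have y: "(norm ?y)\<^sup>2 = (\<Sum>n<N. (norm (g n x))\<^sup>2)"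
      by (rule norm_sum_Pythagorean) (auto simp: pairwise_def orthogonal_def orth')
    have "(norm ?y)\<^sup>2 = inner ?y x"
      unfolding y by (simp add: inner_sum_left projection_norm[OF g])
    also have "\<dots> \<le> norm ?y * norm x" by (rule norm_cauchy_schwarz)
    finally have "norm ?y \<le> norm x" by (cases "?y = 0") (simp_all add: power2_eq_square)
    then show ?thesis unfolding y[symmetric] by (intro power_mono) auto
  qed
  show sq: "summable (\<lambda>n. (norm (g n x))\<^sup>2)"
    by (rule summableI_nonneg_bounded[OF _ bessel]) simp
  note sm = orthogonal_series_summable[OF orth' sq]
  have "g m (x - (\<Sum>n. g n x)) = 0" for m
  proof -
    have "g m (\<Sum>n. g n x) = (\<Sum>n. g m (g n x))"
      by (rule bounded_linear.suminf[OF blinfun.bounded_linear_right sm(1)])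
    also have "\<dots> = (\<Sum>n\<in>{m}. g m (g n x))"
      by (rule suminf_finite) (auto simp: orth)
    also have "\<dots> = g m x" by (simp add: projection_idem[OF g])
    finally show ?thesis by (simp add: blinfun.diff_right)
  qed
  then have "x - (\<Sum>n. g n x) = 0" by (rule tot)
  then show "(\<Sum>n. (norm (g n x))\<^sup>2) = (norm x)\<^sup>2" using sm(2) by simp
qed

end

section \<open>Almost isometries in a factor\<close>

locale vN_factor = vN_algebra M for M :: "('a::complex_hilbert_space \<Rightarrow>\<^sub>L 'a) set" +
  assumes factor: "factor M"
begin

text \<open>The vectors annihilated by \<open>G M\<close> form a subspace invariant under both \<open>M\<close> and its commutant,
  so in a factor the projection onto it is scalar.\<close>

lemma projections_connected:
  assumes P: "P \<in> projections M" "P \<noteq> 0" and G: "G \<in> projections M" "G \<noteq> 0"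
  obtains A where "A \<in> M" "G o\<^sub>L A o\<^sub>L P \<noteq> 0"
proof (rule ccontr)
  note choose = that
  assume no: "\<not> thesis"
  have GAP: "G o\<^sub>L A o\<^sub>L P = 0" if "A \<in> M" for A using choose[OF that] no by blast
  have GAP_ap: "G (A (P x)) = 0" if "A \<in> M" for A x
    using arg_cong[OF GAP[OF that], of "\<lambda>B. blinfun_apply B x"] by simp
  have GM: "G \<in> M" using G(1) by (rule projections_M)
  let ?K = "{x. \<forall>A\<in>M. G (blinfun_apply A x) = 0}"
  have K: "closed ?K" "subspace ?K" "\<And>c x. x \<in> ?K \<Longrightarrow> c *\<^sub>C x \<in> ?K"
    "\<And>A x. A \<in> commutant M \<Longrightarrow> x \<in> ?K \<Longrightarrow> A x \<in> ?K"
  proof -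
    have "?K = (\<Inter>A\<in>M. {x. G (blinfun_apply A x) = 0})" by auto
    then show "closed ?K" by (auto intro!: closed_INT closed_Collect_eq continuous_intros)
    show "subspace ?K" by (auto simp: subspace_def blinfun.bilinear_simps)
    have sc0: "c *\<^sub>C (0::'a) = 0" for c using norm_scaleC[of c "0::'a"] by simp
    show "c *\<^sub>C x \<in> ?K" if "x \<in> ?K" for c x
      using that by (simp add: M_scaleC GM sc0)
    show "A x \<in> ?K" if "A \<in> commutant M" "x \<in> ?K" for A x
      using that by (simp add: commutant_apply[OF that(1), symmetric] GM)
  qed
  obtain Q where Q: "Q \<in> projections M" "range Q = ?K"
    using projection_onto[OF K] by blast
  have QM: "Q \<in> M" "op_adj Q = Q" using Q(1) by (auto simp: projections_def)
  have inv: "Q o\<^sub>L (T o\<^sub>L Q) = T o\<^sub>L Q" if T: "T \<in> M" for T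
  proof (rule blinfun_eqI)
    fix x
    have "Q x \<in> ?K" using Q(2) by blast
    then have "G ((A o\<^sub>L T) (Q x)) = 0" if "A \<in> M" for A
      using comp_M[OF that T] by blast
    then have "T (Q x) \<in> ?K" by simp
    then show "(Q o\<^sub>L (T o\<^sub>L Q)) x = (T o\<^sub>L Q) x"
      using projection_range[OF Q(1), of "T (Q x)"] Q(2) by simp
  qed
  have "Q o\<^sub>L T = T o\<^sub>L Q" if T: "T \<in> M" for T
  proof -
    \<comment> \<open>Taking adjoints turns the invariance of the range of \<open>Q\<close> under
      \<open>op_adj T\<close> into its counterpart
      \<open>Q o\<^sub>L T o\<^sub>L Q = Q o\<^sub>L T\<close>; together they make \<open>Q\<close>
      commute with \<open>T\<close>.\<close>
    have "op_adj (Q o\<^sub>L (op_adj T o\<^sub>L Q)) = op_adj (op_adj T o\<^sub>L Q)"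
      using inv[of "op_adj T"] T by simp
    then have "(Q o\<^sub>L T) o\<^sub>L Q = Q o\<^sub>L T" using T QM by simp
    then show ?thesis using inv[OF T] by (simp add: blinfun_compose_assoc)
  qed
  then have "Q \<in> M \<inter> commutant M" using QM by (simp add: commutant_def)
  then obtain c where c: "Q = op_scale c id_blinfun" using factor unfolding factor_def by blast
  obtain x where x: "P x \<noteq> 0" using P(2) blinfun_eqI[of P 0] by auto
  \<comment> \<open>The scalar is 1 because \<open>Q\<close> fixes the nonzero vector
    \<open>P x\<close>; then \<open>?K\<close> is the whole space and \<open>G\<close>
    vanishes.\<close>
  have "P x \<in> range Q" unfolding Q(2) using GAP_ap by blast
  then have "Q (P x) = P x" using projection_range[OF Q(1)] by blast
  then have cx: "c *\<^sub>C P x = P x" by (simp add: c op_scale_apply)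
  have "(c - 1) *\<^sub>C P x = 0"
    using scaleC_add_left[of "c - 1" 1 "P x"] scaleC_of_real[of 1 "P x"] cx by simp
  then have "cmod (c - 1) * norm (P x) = 0" by (metis norm_scaleC norm_zero)
  then have c1: "c = 1" using x by simp
  have "G y = 0" for y
  proof -
    have "Q y = y" using scaleC_of_real[of 1 y] by (simp add: c c1 op_scale_apply)
    then have "y \<in> ?K" using Q(2) by (metis rangeI)
    then show ?thesis using bspec[of M "\<lambda>A. G (A y) = 0" id_blinfun] by simp
  qed
  then show False using G(2) blinfun_eqI[of G 0] by simp
qed

text \<open>A substitute for comparison of projections: some corner
  \<open>G o\<^sub>L A o\<^sub>L P\<close> is nonzero, and once normalized to norm 1 it has a
  spectral projection below \<open>P\<close> at every level \<open>q < 1\<close>.\<close>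

lemma almost_isometric_comparison:
  assumes P: "P \<in> projections M" "P \<noteq> 0" and G: "G \<in> projections M" "G \<noteq> 0" and q: "0 < q" "q < 1"
  shows "\<exists>E\<in>projections M. E \<noteq> 0 \<and>
    (\<exists>B\<in>M. norm B \<le> 1 \<and> (\<forall>x. G (blinfun_apply B x) = B x) \<and>
      (\<forall>x. q * norm (blinfun_apply E x) \<le> norm (B (E x)))) \<and>
    P o\<^sub>L E = E"
proof -
  obtain A where A: "A \<in> M" "G o\<^sub>L A o\<^sub>L P \<noteq> 0"
    using projections_connected[OF P G] by blast
  let ?C = "G o\<^sub>L A o\<^sub>L P"
  define B where "B = (1 / norm ?C) *\<^sub>R ?C"
  have BM: "B \<in> M" using A P G projections_M by (auto simp: B_def)
  have nB: "norm B = 1" using A(2) by (simp add: B_def)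
  have BP: "B o\<^sub>L P = B"
    using P(1) by (simp add: B_def projections_def blinfun_compose.scaleR_left blinfun_compose_assoc)
  have GB: "G (B x) = B x" for x
    by (simp add: B_def blinfun.bilinear_simps projection_idem[OF G(1)])
  have qB: "q < norm B" using q(2) nB by simp
  obtain E where E: "E \<in> projections M" "E \<noteq> 0" "\<And>x. q * norm (E x) \<le> norm (B (E x))" "P o\<^sub>L E = E"
    using spectral_projection[OF BM q(1) qB P(1) BP] by blast
  have "norm B \<le> 1" using nB by simp
  with E BM GB show ?thesis by blast
qed

text \<open>\<open>W\<close> is the sum of the operators
  \<open>J n o\<^sub>L (B n o\<^sub>L g n)\<close>: the \<open>g n\<close> decompose the identity,
  \<open>B n\<close> maps the range of \<open>g n\<close> almost isometrically into that of
  \<open>G\<close>, and \<open>J n\<close> moves it to a separate orthogonal copy inside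
  \<open>E\<close>. Squared norms then add up, so the constants \<open>q\<close> and 1 survive
  summation.\<close>

lemma almost_isometry_into_projection:
  assumes sep: "separable_space (euclidean :: 'a topology)"
    and E: "E \<in> projections M" "\<not> finite_projection M E" and q: "0 < q" "q < 1"
  obtains W where "W \<in> M" "norm W \<le> 1" "\<And>x. E (W x) = W x" "\<And>x. q * norm x \<le> norm (W x)"
proof -
  obtain G and J :: "nat \<Rightarrow> 'a \<Rightarrow>\<^sub>L 'a" where G: "G \<in> projections M" "G \<noteq> 0"
    and J: "\<And>n. J n \<in> M" "\<And>n x. E (J n (G x)) = J n (G x)" "\<And>n x. norm (J n (G x)) = norm (G x)"
      "\<And>m n x y. m \<noteq> n \<Longrightarrow> inner (J m (G x)) (J n (G y)) = 0"
    using infinite_projection_copies[OF E] by blast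
  define good :: "('a \<Rightarrow>\<^sub>L 'a) \<Rightarrow> bool" where "good e \<longleftrightarrow>
    (\<exists>B\<in>M. norm B \<le> 1 \<and> (\<forall>x. G (blinfun_apply B x) = B x) \<and>
      (\<forall>x. q * norm (blinfun_apply e x) \<le> norm (B (e x))))" for e
  have good0: "good 0" unfolding good_def by (rule bexI[of _ 0]) auto
  have good: "\<exists>e\<in>projections M. e \<noteq> 0 \<and> good e \<and> P o\<^sub>L e = e" if "P \<in> projections M" "P \<noteq> 0" for P
    using almost_isometric_comparison[OF that G q] unfolding good_def .
  obtain g :: "nat \<Rightarrow> 'a \<Rightarrow>\<^sub>L 'a" where g: "\<And>n. g n \<in> projections M" "\<And>n. good (g n)"
    "\<And>m n x. m \<noteq> n \<Longrightarrow> g m (g n x) = 0" "\<And>x. (\<And>n. g n x = 0) \<Longrightarrow> x = 0"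
    using maximal_orthogonal_sequence[OF sep good good0] by blast
  obtain B where B: "\<And>n. B n \<in> M" "\<And>n. norm (B n) \<le> 1" "\<And>n x. G (B n x) = B n x"
    "\<And>n x. q * norm (g n x) \<le> norm (B n (g n x))"
    using g(2) unfolding good_def by metis
  define w :: "nat \<Rightarrow> 'a \<Rightarrow>\<^sub>L 'a" where "w n = J n o\<^sub>L (B n o\<^sub>L g n)" for n
  have wM: "w n \<in> M" for n unfolding w_def using J(1) B(1) projections_M[OF g(1)] by blast
  have w_ap: "w n x = J n (G (B n (g n x)))" for n x by (simp add: w_def B(3))
  have w_norm: "norm (w n x) = norm (B n (g n x))" for n x
    using J(3)[of n "B n (g n x)"] by (simp add: w_ap B(3))
  have w_le: "(norm (w n x))\<^sup>2 \<le> (norm (g n x))\<^sup>2" for n x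
  proof -
    have "norm (w n x) \<le> norm (B n) * norm (g n x)" unfolding w_norm by (rule norm_blinfun)
    also have "\<dots> \<le> 1 * norm (g n x)" by (intro mult_right_mono B) simp
    finally show ?thesis by (intro power_mono) auto
  qed
  have w_ge: "q\<^sup>2 * (norm (g n x))\<^sup>2 \<le> (norm (w n x))\<^sup>2" for n x
    using power_mono[OF B(4)[of n x], of 2] q(1) by (simp add: w_norm power_mult_distrib)
  have w_orth: "inner (w m x) (w n x) = 0" if "m \<noteq> n" for m n x
    unfolding w_ap by (rule J(4)[OF that])
  have gsum: "summable (\<lambda>n. (norm (g n x))\<^sup>2)" "(\<Sum>n. (norm (g n x))\<^sup>2) = (norm x)\<^sup>2" for x
    by (rule projection_sequence_complete; fact g)+
  have wsq: "summable (\<lambda>n. (norm (w n x))\<^sup>2)" for x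
    by (rule summable_comparison_test'[OF gsum(1)[of x]]) (simp add: w_le)
  have wsum: "summable (\<lambda>n. w n x)" "(norm (\<Sum>n. w n x))\<^sup>2 = (\<Sum>n. (norm (w n x))\<^sup>2)" for x
    by (rule orthogonal_series_summable[OF w_orth wsq]; assumption)+
  define W0 where "W0 x = (\<Sum>n. w n x)" for x
  have W0_le: "norm (W0 x) \<le> norm x" for x
  proof (rule power2_le_imp_le)
    show "(norm (W0 x))\<^sup>2 \<le> (norm x)\<^sup>2"
      using suminf_le[OF w_le wsq gsum(1), of x] by (simp only: W0_def wsum(2) gsum(2))
  qed simp
  have W0_ge: "q * norm x \<le> norm (W0 x)" for x
  proof (rule power2_le_imp_le)
    have "(q * norm x)\<^sup>2 = (\<Sum>n. q\<^sup>2 * (norm (g n x))\<^sup>2)"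
      unfolding power_mult_distrib gsum(2)[of x, symmetric] by (rule suminf_mult[OF gsum(1), symmetric])
    also have "\<dots> \<le> (norm (W0 x))\<^sup>2"
      unfolding W0_def wsum(2) by (rule suminf_le[OF w_ge summable_mult[OF gsum(1)] wsq])
    finally show "(q * norm x)\<^sup>2 \<le> (norm (W0 x))\<^sup>2" .
  qed simp
  have "bounded_linear W0"
  proof (rule bounded_linear_intro)
    show "W0 (x + y) = W0 x + W0 y" for x y
      unfolding W0_def blinfun.add_right by (rule suminf_add[OF wsum(1) wsum(1), symmetric])
    show "W0 (r *\<^sub>R x) = r *\<^sub>R W0 x" for r x
      unfolding W0_def blinfun.scaleR_right by (rule suminf_scaleR_right[OF wsum(1), symmetric])
    show "norm (W0 x) \<le> norm x * 1" for x using W0_le by simp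
  qed
  then have W: "Blinfun W0 x = W0 x" for x by (simp add: bounded_linear_Blinfun_apply)
  show thesis
  proof (rule that[of "Blinfun W0"])
    \<comment> \<open>The partial sums are only known to converge pointwise, hence the strong
      limit.\<close>
    show "Blinfun W0 \<in> M"
    proof (rule strong_limit_M)
      show "(\<Sum>n<N. w n) \<in> M" for N by (induction N) (auto simp: wM)
      show "(\<lambda>N. (\<Sum>n<N. w n) x) \<longlonglongrightarrow> Blinfun W0 x" for x
        unfolding W W0_def blinfun.sum_left by (rule summable_LIMSEQ[OF wsum(1)])
    qed
    show "norm (Blinfun W0) \<le> 1"
      by (rule norm_blinfun_bound) (simp_all add: W W0_le)
    show "E (Blinfun W0 x) = Blinfun W0 x" for x
    proof -
      have "E (\<Sum>n. w n x) = (\<Sum>n. E (w n x))"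
        by (rule bounded_linear.suminf[OF blinfun.bounded_linear_right wsum(1)])
      then show ?thesis by (simp add: W W0_def w_ap J(2))
    qed
    show "q * norm x \<le> norm (Blinfun W0 x)" for x by (simp add: W W0_ge)
  qed
qed

text \<open>Type III makes the spectral projection \<open>E\<close> infinite, so the whole space
  maps almost isometrically into a subspace on which \<open>T\<close> is bounded below, and
  \<open>T o\<^sub>L W\<close> has a left inverse.\<close>

lemma factorization_of_identity:
  assumes sep: "separable_space (euclidean :: 'a topology)" and III: "type_III M"
    and T: "T \<in> M" and d: "0 < d" "d < norm T"
  obtains A W where "A \<in> M" "W \<in> M" "A o\<^sub>L (T o\<^sub>L W) = id_blinfun" "norm A \<le> 1 / d" "norm W \<le> 1"
proof -
  \<comment> \<open>An intermediate level leaves room for two losses: \<open>T\<close> is bounded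
    below by \<open>e\<close> on the range of \<open>E\<close> and \<open>W\<close> by
    \<open>d / e\<close>, with product \<open>d\<close>.\<close>
  define e where "e = (d + norm T) / 2"
  have e: "0 < e" "e < norm T" "d < e" using d by (auto simp: e_def)
  have id: "id_blinfun \<in> projections M" "T o\<^sub>L id_blinfun = T"
    by (simp_all add: projections_def)
  obtain E where E: "E \<in> projections M" "E \<noteq> 0" "\<And>x. e * norm (E x) \<le> norm (T (E x))"
    "id_blinfun o\<^sub>L E = E"
    by (rule spectral_projection[OF T e(1,2) id]) (rule that)
  have inf: "\<not> finite_projection M E" using III E(1,2) unfolding type_III_def by blast
  have q: "0 < d / e" "d / e < 1" using d e by auto
  obtain W where W: "W \<in> M" "norm W \<le> 1" "\<And>x. E (W x) = W x" "\<And>x. d / e * norm x \<le> norm (W x)"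
    using almost_isometry_into_projection[OF sep E(1) inf q] by blast
  have below: "d * norm x \<le> norm ((T o\<^sub>L W) x)" for x
  proof -
    have "d * norm x = e * (d / e * norm x)" using e by simp
    also have "\<dots> \<le> e * norm (W x)" using W(4) e by (intro mult_left_mono) auto
    also have "\<dots> \<le> norm (T (W x))" using E(3)[of "W x"] W(3) by simp
    finally show ?thesis by simp
  qed
  obtain A where "A \<in> M" "A o\<^sub>L (T o\<^sub>L W) = id_blinfun" "norm A \<le> 1 / d"
    using left_inverse_bounded_below[OF comp_M[OF T W(1)] d(1) below] by blast
  then show thesis using that W(1,2) by blast
qed

end

section \<open>Comparison of the seminorm with the operator norm\<close>

theorem theorem3p29:
  fixes M :: "('a::complex_hilbert_space \<Rightarrow>\<^sub>L 'a) set"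
    and N :: "('a \<Rightarrow>\<^sub>L 'a) \<Rightarrow> ennreal"
  assumes "separable_space (euclidean :: 'a topology)"
    and "factor M" and "type_III M"
    and "generalized_seminorm M N" and "unitarily_invariant M N"
  shows "\<exists>a::real. a > 0 \<and> (\<forall>T\<in>M. N T = ennreal (a * norm T))"
proof -
  interpret vN_factor M
    by unfold_locales (use assms(2) in \<open>auto simp: factor_def\<close>)
  have scaleC: "N (op_scale c T) = ennreal (cmod c) * N T" if "T \<in> M" for c T
    using assms(4) that by (simp add: generalized_seminorm_def)
  have subadd: "N (S + T) \<le> N S + N T" if "S \<in> M" "T \<in> M" for S T
    using assms(4) that by (simp add: generalized_seminorm_def)
  have scale: "N (r *\<^sub>R T) = ennreal r * N T" if "r \<ge> 0" "T \<in> M" for r T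
    using scaleC[OF that(2), of "complex_of_real r"] that(1) by (simp add: op_scale_of_real)
  have inv: "N (U o\<^sub>L T o\<^sub>L V) = N T" if "T \<in> M" "U \<in> unitaries M" "V \<in> unitaries M" for T U V
    using assms(5) that by (simp add: unitarily_invariant_def)
  have inv_left: "N (U o\<^sub>L T) = N T" if "U \<in> unitaries M" "T \<in> M" for U T
    using inv[OF that(2,1) unitaries_id] by simp
  have inv_right: "N (T o\<^sub>L U) = N T" if "U \<in> unitaries M" "T \<in> M" for U T
    using inv[OF that(2) unitaries_id that(1)] by simp
  have mult_left: "N (S o\<^sub>L T) \<le> ennreal (norm S) * N T" if "S \<in> M" "T \<in> M" for S T
    by (rule seminorm_mult_left[OF subadd scale inv_left that]) auto
  have mult_right: "N (T o\<^sub>L S) \<le> ennreal (norm S) * N T" if "S \<in> M" "T \<in> M" for S T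
    by (rule seminorm_mult_right[OF subadd scale inv_right that]) auto
  let ?n = "N id_blinfun"
  have upper: "N T \<le> ennreal (norm T) * ?n" if "T \<in> M" for T
    using mult_left[OF that id_M] by simp
  have lower: "ennreal (norm T) * ?n \<le> N T" if T: "T \<in> M" "T \<noteq> 0" for T
  proof -
    have nT: "norm T > 0" using T(2) by simp
    have "?n \<le> ennreal (1 / norm T) * N T"
    proof (rule ennreal_le_mult_limit)
      show "1 / norm T > 0" using nT by simp
      fix c assume c: "c > 1 / norm T"
      then have c0: "c > 0" using nT by (meson divide_pos_pos less_trans zero_less_one)
      \<comment> \<open>With the level \<open>1 / c\<close> the left inverse \<open>A\<close> has
        norm at most \<open>c\<close>, and the ideal property on both sides bounds the seminorm of
        the identity.\<close>
      have d: "0 < 1 / c" "1 / c < norm T" using c c0 nT by (auto simp: field_simps)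
      obtain A W where A: "A \<in> M" "W \<in> M" "A o\<^sub>L (T o\<^sub>L W) = id_blinfun" "norm A \<le> 1 / (1 / c)" "norm W \<le> 1"
        using factorization_of_identity[OF assms(1,3) T(1) d] by blast
      have "?n \<le> ennreal (norm A) * N (T o\<^sub>L W)"
        using mult_left[OF A(1), of "T o\<^sub>L W"] T A by simp
      also have "\<dots> \<le> ennreal c * (ennreal (norm W) * N T)"
        using mult_right[OF A(2) T(1)] A(4) by (intro mult_mono ennreal_leI) auto
      also have "\<dots> \<le> ennreal c * (ennreal 1 * N T)"
        using A(5) by (intro mult_left_mono mult_right_mono ennreal_leI) auto
      finally show "?n \<le> ennreal c * N T" by simp
    qed
    then have "ennreal (norm T) * ?n \<le> ennreal (norm T) * (ennreal (1 / norm T) * N T)"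
      by (intro mult_left_mono) auto
    also have "\<dots> = N T"
      using nT by (simp add: mult.assoc[symmetric] ennreal_mult[symmetric])
    finally show ?thesis .
  qed
  obtain T0 where T0: "T0 \<in> M" "T0 \<noteq> 0" "0 < N T0" "N T0 < \<infinity>"
    using assms(4) unfolding generalized_seminorm_def by blast
  \<comment> \<open>The element \<open>T0\<close> of finite nonzero seminorm excludes both
    degenerate values of \<open>?n\<close>: \<open>lower\<close> rules out infinity and
    \<open>upper\<close> rules out zero.\<close>
  have "?n \<noteq> \<infinity>"
  proof
    assume "?n = \<infinity>"
    then have "ennreal (norm T0) * ?n = \<infinity>" using T0(2) by (simp add: ennreal_mult_top)
    then show False using lower[OF T0(1,2)] T0(4) by simp
  qed
  moreover have "?n \<noteq> 0" using upper[OF T0(1)] T0(3) by auto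
  ultimately obtain a where a: "?n = ennreal a" "a > 0"
    by (cases ?n) (auto simp: less_le)
  have "N T = ennreal (a * norm T)" if T: "T \<in> M" for T
  proof (cases "T = 0")
    case True
    then show ?thesis using scale[of 0 0] by simp
  next
    case False
    have "N T = ennreal (norm T) * ?n" using upper[OF T] lower[OF T False] by (rule antisym)
    then show ?thesis using a by (simp add: ennreal_mult[symmetric] mult.commute)
  qed
  then show ?thesis using a(2) by blast
qed

end
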